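(* For each integer $d \ge 4$, there is a simplicial $d$-polytope whose graph has minimum degree at least $d(d+1)/2$ and has a nontrivial minimum edge cut with exactly $d(d+1)/2$ edges.
   Context: A polytope is the convex hull of finitely many points; its dimension is the dimension of its affine hull, and a $d$-polytope is a polytope of dimension $d$. Its faces are its intersections with its supporting hyperplanes, together with the polytope itself. A polytope is simplicial when all its proper faces are simplices. The graph of a polytope has as vertices its $0$-dimensional faces and as edges its $1$-dimensional faces. For a connected graph $G$ with vertex set $V$, an edge cut is a set $\mathcal{E}(V_\circ, V_\bullet)$ consisting of all edges with one endpoint in $V_\circ$ and the other in $V_\bullet$, for some partition $V = V_\circ \sqcup V_\bullet$ with $V_\circ \neq \varnothing \neq V_\bullet$. A minimum edge cut is an edge cut of minimal cardinality among all edge cuts of $G$. An edge cut is trivial if it is the set of all edges incident to some given vertex, and nontrivial otherwise. *)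

theory Defs
  imports "HOL-Analysis.Analysis"
begin

(* Undirected simple graphs, given by a vertex set V and a set E of 2-element subsets of V. *)

definition incident_edges :: "'v set set \<Rightarrow> 'v \<Rightarrow> 'v set set" where
  "incident_edges E v = {e \<in> E. v \<in> e}"

definition degree :: "'v set set \<Rightarrow> 'v \<Rightarrow> nat" where
  "degree E v = card (incident_edges E v)"

definition min_degree :: "'v set \<Rightarrow> 'v set set \<Rightarrow> nat" where
  "min_degree V E = Min (degree E ` V)"

definition edges_between :: "'v set set \<Rightarrow> 'v set \<Rightarrow> 'v set \<Rightarrow> 'v set set" where
  "edges_between E A B = {e \<in> E. \<exists>u\<in>A. \<exists>v\<in>B. e = {u, v}}"

definition edge_cut :: "'v set \<Rightarrow> 'v set set \<Rightarrow> 'v set set \<Rightarrow> bool" where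
  "edge_cut V E C \<longleftrightarrow>
    (\<exists>A B. A \<union> B = V \<and> A \<inter> B = {} \<and> A \<noteq> {} \<and> B \<noteq> {} \<and> C = edges_between E A B)"

definition minimum_edge_cut :: "'v set \<Rightarrow> 'v set set \<Rightarrow> 'v set set \<Rightarrow> bool" where
  "minimum_edge_cut V E C \<longleftrightarrow>
    edge_cut V E C \<and> (\<forall>D. edge_cut V E D \<longrightarrow> card C \<le> card D)"

definition trivial_edge_cut :: "'v set \<Rightarrow> 'v set set \<Rightarrow> 'v set set \<Rightarrow> bool" where
  "trivial_edge_cut V E C \<longleftrightarrow> edge_cut V E C \<and> (\<exists>v\<in>V. C = incident_edges E v)"

(* Faces of a polytope P are intersections with supporting hyperplanes, or P itself; this is
   exposed_face_of, which also admits the empty face, a (-1)-simplex for the library. *)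

definition simplicial_polytope :: "'a::euclidean_space set \<Rightarrow> bool" where
  "simplicial_polytope P \<longleftrightarrow>
    polytope P \<and> (\<forall>F. F exposed_face_of P \<and> F \<noteq> P \<longrightarrow> (\<exists>n. n simplex F))"

definition graph_vertices :: "'a::euclidean_space set \<Rightarrow> 'a set" where
  "graph_vertices P = {v. {v} exposed_face_of P}"

(* A 1-dimensional face is represented by the set of its two endpoints. *)
definition graph_edges :: "'a::euclidean_space set \<Rightarrow> 'a set set" where
  "graph_edges P = {F \<inter> graph_vertices P |F. F exposed_face_of P \<and> aff_dim F = 1}"

end

theory Submission
  imports Defs
begin

text \<open>
The polytope consists of two neighbourly pieces of \<open>n = d(d+1)/2 + 1\<close> vertices each, joined by a
narrow neck. Each piece has a distinguished simplex facet with \<open>d\<close> vertices, its \<^emph>\<open>nodes\<close>; the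
remaining vertices form a \<^emph>\<open>cap\<close> over this facet. The neck is a prism over the \<open>(d-1)\<close>-simplex whose
two ends are the two facets of nodes, except that the end points are moved so that each
quadrilateral 2-face breaks along one diagonal. Edges between the two pieces join nodes only: they
are the \<open>d\<close> vertical edges of the prism and one diagonal for each of its \<open>d(d-1)/2\<close> squares, in
total \<open>d(d+1)/2\<close>. Since each piece is a clique, every vertex has degree at least \<open>n - 1 = d(d+1)/2\<close>,
and an edge cut that separates two vertices of the same piece has at least \<open>n - 1\<close> edges. Hence the
cut between the pieces is minimum, and it is not trivial because each vertex also has neighbours in
its own piece (\<open>two_cliques_minimum_edge_cut\<close>).

A convex hull is understood through the affine functions that are nonnegative on its points: the
faces are spanned by their zero sets. If all proper zero sets are affinely independent, the polytope
is simplicial and its edges are the zero sets with two elements. So everything reduces to statements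
about the signs of affine functions at the \<open>2 n\<close> points.

The points are chosen so that these signs can be computed. Homogeneous coordinates in which the nodes
of a piece form part of a basis turn affine functions into interpolation data: the value at the
\<open>k\<close>-th vertex of a piece is, up to a positive factor, the value at \<open>k\<close> of a real polynomial of degree
at most \<open>d\<close>, whose values at \<open>0, \<dots>, d-1\<close> and whose coefficient of degree \<open>d\<close> can be prescribed
(\<open>cluster_functional\<close>). Each piece is thus a projective image of a cyclic polytope. As \<open>d \<ge> 4\<close>, the
polynomials \<open>(x - u)\<^sup>2 (x - v)\<^sup>2\<close> exhibit all pairs inside a piece as edges
(\<open>low_edge\<close>, \<open>high_edge\<close>), and the polynomials of degree at most \<open>d\<close> show that the points of one
piece are in general position. The projective image is chosen such that a function of this kind for
one piece is automatically positive on the other piece. Zero sets that meet both pieces contain only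
nodes, and there explicit linear inequalities decide (\<open>crossing_edge\<close>, \<open>zeros_crossing\<close>).
\<close>

section \<open>Faces and graphs of convex hulls of finite sets\<close>

lemma exposed_face_of_convex_hull_iff:
  fixes V :: "'a::euclidean_space set"
  assumes "finite V"
  shows "F exposed_face_of (convex hull V) \<longleftrightarrow>
    (\<exists>a b. (\<forall>v\<in>V. 0 \<le> a + b \<bullet> v) \<and> F = convex hull {v\<in>V. a + b \<bullet> v = 0})"
proof
  assume F: "F exposed_face_of (convex hull V)"
  then obtain a b where ab: "convex hull V \<subseteq> {x. a \<bullet> x \<le> b}" "F = convex hull V \<inter> {x. a \<bullet> x = b}"
    and face: "F face_of convex hull V"
    unfolding exposed_face_of_def by blast
  obtain S where S: "S \<subseteq> V" "F = convex hull S"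
    using face_of_convex_hull_subset[OF finite_imp_compact[OF assms] face] by blast
  have "convex hull {v\<in>V. b + (- a) \<bullet> v = 0} \<subseteq> convex hull V \<inter> {x. a \<bullet> x = b}"
    by (rule hull_minimal) (auto simp: hull_inc convex_Int convex_hyperplane)
  moreover have "S \<subseteq> {v\<in>V. b + (- a) \<bullet> v = 0}"
  proof
    fix s assume "s \<in> S"
    then have "s \<in> F" using S(2) by (simp add: hull_inc)
    then show "s \<in> {v\<in>V. b + (- a) \<bullet> v = 0}"
      using ab(2) S(1) \<open>s \<in> S\<close> by auto
  qed
  ultimately have "F = convex hull {v\<in>V. b + (- a) \<bullet> v = 0}"
    using S(2) ab(2) by (metis hull_mono subset_antisym)
  moreover have "\<forall>v\<in>V. 0 \<le> b + (- a) \<bullet> v"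
    using ab(1) by (auto dest: hull_inc)
  ultimately show "\<exists>a b. (\<forall>v\<in>V. 0 \<le> a + b \<bullet> v) \<and> F = convex hull {v\<in>V. a + b \<bullet> v = 0}"
    by blast
next
  assume "\<exists>a b. (\<forall>v\<in>V. 0 \<le> a + b \<bullet> v) \<and> F = convex hull {v\<in>V. a + b \<bullet> v = 0}"
  then obtain a b where ab: "\<And>v. v \<in> V \<Longrightarrow> 0 \<le> a + b \<bullet> v"
    and F: "F = convex hull {v\<in>V. a + b \<bullet> v = 0}" by blast
  have "convex hull V \<subseteq> {x. - b \<bullet> x \<le> a}"
    proof (rule hull_minimal)
    show "V \<subseteq> {x. - b \<bullet> x \<le> a}" using ab by (fastforce simp: field_simps)
  qed (rule convex_halfspace_le)
  then have le: "- b \<bullet> x \<le> a" if "x \<in> convex hull V" for x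
    using that by auto
  have face: "(convex hull V \<inter> {x. - b \<bullet> x = a}) face_of (convex hull V)"
    by (rule face_of_Int_supporting_hyperplane_le[OF convex_convex_hull le])
  obtain S where S: "S \<subseteq> V" "convex hull V \<inter> {x. - b \<bullet> x = a} = convex hull S"
    using face_of_convex_hull_subset[OF finite_imp_compact[OF assms] face] by blast
  have "S \<subseteq> {v\<in>V. a + b \<bullet> v = 0}"
  proof
    fix s assume "s \<in> S"
    then have "s \<in> convex hull V \<inter> {x. - b \<bullet> x = a}" using S(2) by (simp add: hull_inc)
    then show "s \<in> {v\<in>V. a + b \<bullet> v = 0}"
      using S(1) \<open>s \<in> S\<close> by auto
  qed
  moreover have "F \<subseteq> convex hull V \<inter> {x. - b \<bullet> x = a}"
    unfolding F
  proof (rule hull_minimal)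
    show "convex (convex hull V \<inter> {x. - b \<bullet> x = a})"
      by (intro convex_Int convex_convex_hull convex_hyperplane)
  qed (auto simp: hull_inc)
  ultimately have "F = convex hull V \<inter> {x. - b \<bullet> x = a}"
    unfolding F S(2) by (simp add: hull_mono subset_antisym)
  then show "F exposed_face_of (convex hull V)"
    unfolding exposed_face_of_def using face le by blast
qed

lemma convex_hull_zero_set_Int:
  fixes V :: "'a::euclidean_space set"
  shows "convex hull {v\<in>V. a + b \<bullet> v = 0} \<inter> V = {v\<in>V. a + b \<bullet> v = 0}"
proof -
  have "convex hull {v\<in>V. a + b \<bullet> v = 0} \<subseteq> {x. b \<bullet> x = - a}"
    by (rule hull_minimal) (auto simp: convex_hyperplane)
  then show ?thesis by (auto intro: hull_inc)
qed

lemma graph_vertices_convex_hull: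
  fixes V :: "'a::euclidean_space set"
  assumes "finite V"
    and "\<And>v. v \<in> V \<Longrightarrow> \<exists>a b. (\<forall>x\<in>V. 0 \<le> a + b \<bullet> x) \<and> {x\<in>V. a + b \<bullet> x = 0} = {v}"
  shows "graph_vertices (convex hull V) = V"
proof
  show "graph_vertices (convex hull V) \<subseteq> V"
    unfolding graph_vertices_def exposed_face_of_def
    by (auto simp: face_of_singleton dest: extreme_point_of_convex_hull)
  show "V \<subseteq> graph_vertices (convex hull V)"
  proof
    fix v assume "v \<in> V"
    then obtain a b where "\<forall>x\<in>V. 0 \<le> a + b \<bullet> x" "{x\<in>V. a + b \<bullet> x = 0} = {v}"
      using assms(2) by blast
    then have "{v} exposed_face_of (convex hull V)"
      unfolding exposed_face_of_convex_hull_iff[OF assms(1)]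
      by (metis convex_hull_singleton)
    then show "v \<in> graph_vertices (convex hull V)"
      by (simp add: graph_vertices_def)
  qed
qed

lemma simplicial_polytope_convex_hull:
  fixes V :: "'a::euclidean_space set"
  assumes "finite V"
    and "\<And>a b. (\<And>x. x \<in> V \<Longrightarrow> 0 \<le> a + b \<bullet> x) \<Longrightarrow> \<not> (\<forall>x\<in>V. a + b \<bullet> x = 0)
      \<Longrightarrow> \<not> affine_dependent {x\<in>V. a + b \<bullet> x = 0}"
  shows "simplicial_polytope (convex hull V)"
  unfolding simplicial_polytope_def
proof (intro conjI allI impI)
  show "polytope (convex hull V)"
    using assms(1) by (auto simp: polytope_def)
  fix F assume F: "F exposed_face_of (convex hull V) \<and> F \<noteq> convex hull V"
  then obtain a b where ab: "\<forall>v\<in>V. 0 \<le> a + b \<bullet> v" "F = convex hull {v\<in>V. a + b \<bullet> v = 0}"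
    unfolding exposed_face_of_convex_hull_iff[OF assms(1)] by blast
  have "\<not> (\<forall>x\<in>V. a + b \<bullet> x = 0)"
  proof
    assume "\<forall>x\<in>V. a + b \<bullet> x = 0"
    then have "{v\<in>V. a + b \<bullet> v = 0} = V" by auto
    then show False using F ab(2) by simp
  qed
  then have "\<not> affine_dependent {x\<in>V. a + b \<bullet> x = 0}"
    using assms(2) ab(1) by blast
  then show "\<exists>n. n simplex F"
    unfolding simplex_def ab(2)
    by (intro exI[of _ "int (card {v\<in>V. a + b \<bullet> v = 0}) - 1"] exI[of _ "{v\<in>V. a + b \<bullet> v = 0}"]) auto
qed

lemma graph_edges_convex_hull:
  fixes V :: "'a::euclidean_space set"
  assumes "finite V" and "graph_vertices (convex hull V) = V" and "aff_dim V \<noteq> 1"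
    and indep: "\<And>a b. (\<And>x. x \<in> V \<Longrightarrow> 0 \<le> a + b \<bullet> x) \<Longrightarrow> \<not> (\<forall>x\<in>V. a + b \<bullet> x = 0)
      \<Longrightarrow> \<not> affine_dependent {x\<in>V. a + b \<bullet> x = 0}"
  shows "e \<in> graph_edges (convex hull V) \<longleftrightarrow>
    (\<exists>a b. (\<forall>x\<in>V. 0 \<le> a + b \<bullet> x) \<and> e = {x\<in>V. a + b \<bullet> x = 0} \<and> card e = 2)"
    (is "_ \<longleftrightarrow> ?R")
proof
  assume "e \<in> graph_edges (convex hull V)"
  then obtain F where F: "F exposed_face_of (convex hull V)" "aff_dim F = 1" "e = F \<inter> V"
    unfolding graph_edges_def assms(2) by blast
  then obtain a b where ab: "\<forall>v\<in>V. 0 \<le> a + b \<bullet> v" "F = convex hull {v\<in>V. a + b \<bullet> v = 0}"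
    unfolding exposed_face_of_convex_hull_iff[OF assms(1)] by blast
  have e: "e = {v\<in>V. a + b \<bullet> v = 0}"
    unfolding F(3) ab(2) by (rule convex_hull_zero_set_Int)
  have dim: "aff_dim {v\<in>V. a + b \<bullet> v = 0} = 1"
    using F(2) unfolding ab(2) aff_dim_convex_hull .
  have "\<not> (\<forall>x\<in>V. a + b \<bullet> x = 0)"
  proof
    assume "\<forall>x\<in>V. a + b \<bullet> x = 0"
    then have "{v\<in>V. a + b \<bullet> v = 0} = V" by auto
    then show False using dim assms(3) by simp
  qed
  then have "\<not> affine_dependent {v\<in>V. a + b \<bullet> v = 0}"
    using indep ab(1) by blast
  then have "card e = 2"
    using aff_dim_affine_independent[of e] dim unfolding e[symmetric] by linarith
  then show ?R using ab(1) e by (intro exI[of _ a] exI[of _ b] conjI)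
next
  assume ?R
  then obtain a b where ab: "\<forall>x\<in>V. 0 \<le> a + b \<bullet> x" "e = {x\<in>V. a + b \<bullet> x = 0}" "card e = 2"
    by blast
  then obtain u v where uv: "e = {u, v}" "u \<noteq> v" by (meson card_2_iff)
  have "convex hull e exposed_face_of convex hull V"
    unfolding exposed_face_of_convex_hull_iff[OF assms(1)]
    using ab(1,2) by (intro exI[of _ a] exI[of _ b] conjI) simp_all
  moreover have "aff_dim (convex hull e) = 1"
    using uv by (simp add: aff_dim_convex_hull aff_dim_2)
  moreover have "e = convex hull e \<inter> graph_vertices (convex hull V)"
    using convex_hull_zero_set_Int[of V a b, folded ab(2)] assms(2) by simp
  ultimately show "e \<in> graph_edges (convex hull V)"
    unfolding graph_edges_def by blast
qed

text \<open>The zero set of an affine function is an affine set; so a point at which some function vanishing at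
the other points does not vanish lies outside their affine hull.\<close>

lemma affine_independent_by_separation:
  fixes S :: "'a::euclidean_space set"
  assumes "\<And>s. s \<in> S \<Longrightarrow> \<exists>a b. a + b \<bullet> s \<noteq> 0 \<and> (\<forall>x\<in>S - {s}. a + b \<bullet> x = 0)"
  shows "\<not> affine_dependent S"
proof
  assume "affine_dependent S"
  then obtain s where s: "s \<in> S" "s \<in> affine hull (S - {s})"
    unfolding affine_dependent_def by blast
  obtain a b where ab: "a + b \<bullet> s \<noteq> 0" "\<forall>x\<in>S - {s}. a + b \<bullet> x = 0"
    using assms[OF s(1)] by blast
  have "affine hull (S - {s}) \<subseteq> {x. b \<bullet> x = - a}"
  proof (rule hull_minimal)
    show "S - {s} \<subseteq> {x. b \<bullet> x = - a}" using ab(2) by (force simp: eq_neg_iff_add_eq_0 add.commute)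
  qed (rule affine_hyperplane)
  then show False using s(2) ab(1) by auto
qed

section \<open>Edge cuts of graphs made of two cliques\<close>

lemma clique_degree:
  assumes "finite E" "finite K" "\<And>u v. u \<in> K \<Longrightarrow> v \<in> K \<Longrightarrow> u \<noteq> v \<Longrightarrow> {u, v} \<in> E" "v \<in> K"
  shows "card K - 1 \<le> degree E v"
proof -
  have "(\<lambda>u. {v, u}) ` (K - {v}) \<subseteq> incident_edges E v"
    using assms(3,4) by (auto simp: incident_edges_def)
  moreover have "inj_on (\<lambda>u. {v, u}) (K - {v})"
    by (auto simp: inj_on_def doubleton_eq_iff)
  moreover have "finite (incident_edges E v)"
    using assms(1) by (simp add: incident_edges_def)
  ultimately have "card (K - {v}) \<le> degree E v"
    unfolding degree_def by (metis card_image card_mono)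
  then show ?thesis using assms(2,4) by simp
qed

text \<open>If the cut splits a clique into parts of sizes \<open>p\<close> and \<open>q\<close>, it contains \<open>p q\<close> of its edges, and
\<open>p q \<ge> p + q - 1\<close> for positive \<open>p\<close> and \<open>q\<close>.\<close>

lemma clique_cut:
  assumes "finite E" "finite K" "\<And>u v. u \<in> K \<Longrightarrow> v \<in> K \<Longrightarrow> u \<noteq> v \<Longrightarrow> {u, v} \<in> E"
    and "A \<inter> B = {}" "K \<subseteq> A \<union> B" "K \<inter> A \<noteq> {}" "K \<inter> B \<noteq> {}"
  shows "card K - 1 \<le> card (edges_between E A B)"
proof -
  let ?p = "card (K \<inter> A)" and ?q = "card (K \<inter> B)"
  have "(\<lambda>(u, v). {u, v}) ` ((K \<inter> A) \<times> (K \<inter> B)) \<subseteq> edges_between E A B"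
    using assms(3,4) by (fastforce simp: edges_between_def)
  moreover have "inj_on (\<lambda>(u, v). {u, v}) ((K \<inter> A) \<times> (K \<inter> B))"
    using assms(4) by (auto simp: inj_on_def doubleton_eq_iff)
  moreover have "finite (edges_between E A B)"
    using assms(1) by (simp add: edges_between_def)
  ultimately have "card ((K \<inter> A) \<times> (K \<inter> B)) \<le> card (edges_between E A B)"
    by (intro card_inj_on_le)
  then have le: "?p * ?q \<le> card (edges_between E A B)"
    by (simp only: card_cartesian_product)
  have "card ((K \<inter> A) \<union> (K \<inter> B)) = ?p + ?q"
    by (rule card_Un_disjoint) (use assms(2,4) in auto)
  moreover have "(K \<inter> A) \<union> (K \<inter> B) = K" using assms(5) by auto
  ultimately have K: "card K = ?p + ?q" by simp
  have "?p \<ge> 1" "?q \<ge> 1"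
    using assms(2,6,7) by (simp_all add: Suc_le_eq card_gt_0_iff)
  then obtain p q where "?p = Suc p" "?q = Suc q"
    by (metis One_nat_def Suc_le_D)
  then have "card K - 1 \<le> ?p * ?q" using K by simp
  then show ?thesis using le by simp
qed

text \<open>Every edge cut either is the cut between the two cliques or splits one of them, and then
\<open>clique_cut\<close> bounds it from below. It differs from the star of a vertex, since that star also contains
an edge inside the clique of the vertex.\<close>

lemma two_cliques_minimum_edge_cut:
  fixes V1 V2 :: "'v set"
  assumes fin: "finite V1" "finite V2" "finite E"
    and disj: "V1 \<inter> V2 = {}" and ne: "V1 \<noteq> {}" "V2 \<noteq> {}"
    and K1: "\<And>u v. u \<in> V1 \<Longrightarrow> v \<in> V1 \<Longrightarrow> u \<noteq> v \<Longrightarrow> {u, v} \<in> E"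
    and K2: "\<And>u v. u \<in> V2 \<Longrightarrow> v \<in> V2 \<Longrightarrow> u \<noteq> v \<Longrightarrow> {u, v} \<in> E"
    and m: "card (edges_between E V1 V2) = m" "m < card V1" "m < card V2" "2 \<le> card V1" "2 \<le> card V2"
  shows "m \<le> min_degree (V1 \<union> V2) E"
    and "minimum_edge_cut (V1 \<union> V2) E (edges_between E V1 V2)"
    and "\<not> trivial_edge_cut (V1 \<union> V2) E (edges_between E V1 V2)"
proof -
  have "m \<le> degree E v" if "v \<in> V1 \<union> V2" for v
    using that clique_degree[OF fin(3,1) K1, of v] clique_degree[OF fin(3,2) K2, of v] m by auto
  then show "m \<le> min_degree (V1 \<union> V2) E"
    unfolding min_degree_def using fin ne by (subst Min_ge_iff) auto
  have "card (edges_between E V1 V2) \<le> card D" if D: "edge_cut (V1 \<union> V2) E D" for D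
  proof -
    obtain A B where AB: "A \<union> B = V1 \<union> V2" "A \<inter> B = {}" "A \<noteq> {}" "B \<noteq> {}" "D = edges_between E A B"
      using D unfolding edge_cut_def by blast
    consider "V1 \<inter> A \<noteq> {}" "V1 \<inter> B \<noteq> {}" | "V2 \<inter> A \<noteq> {}" "V2 \<inter> B \<noteq> {}"
      | "A = V1" "B = V2" | "A = V2" "B = V1"
      using AB disj by blast
    then show ?thesis
    proof cases
      case 1
      then show ?thesis using clique_cut[OF fin(3,1) K1 AB(2)] AB m by auto
    next
      case 2
      then show ?thesis using clique_cut[OF fin(3,2) K2 AB(2)] AB m by auto
    next
      case 3
      then show ?thesis using AB by simp
    next
      case 4
      have "edges_between E V1 V2 = edges_between E V2 V1"
        unfolding edges_between_def by (auto simp: insert_commute)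
      then show ?thesis using AB 4 by simp
    qed
  qed
  moreover have "edge_cut (V1 \<union> V2) E (edges_between E V1 V2)"
    unfolding edge_cut_def using disj ne by blast
  ultimately show "minimum_edge_cut (V1 \<union> V2) E (edges_between E V1 V2)"
    unfolding minimum_edge_cut_def by blast
  have "edges_between E V1 V2 \<noteq> incident_edges E v" if v: "v \<in> V1 \<union> V2" for v
  proof
    assume eq: "edges_between E V1 V2 = incident_edges E v"
    obtain K where K: "K = V1 \<or> K = V2" "v \<in> K" using v by auto
    then have "card K \<ge> 2" "finite K" using m fin by auto
    then obtain u where u: "u \<in> K" "u \<noteq> v"
      by (metis card_1_singleton_iff card_le_Suc0_iff_eq K(2) not_less_eq_eq numeral_2_eq_2)
    then have "{v, u} \<in> incident_edges E v"
      using K K1 K2 by (auto simp: incident_edges_def)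
    moreover have "{v, u} \<notin> edges_between E V1 V2"
      using K u disj by (auto simp: edges_between_def doubleton_eq_iff)
    ultimately show False using eq by simp
  qed
  then show "\<not> trivial_edge_cut (V1 \<union> V2) E (edges_between E V1 V2)"
    unfolding trivial_edge_cut_def by blast
qed

lemma card_ordered_pairs: "card {(i, j). i < d \<and> j \<le> i} = d * (d + 1) div (2::nat)"
proof -
  have "{(i, j). i < d \<and> j \<le> i} = (SIGMA i:{..<d}. {..i})" by auto
  then have "card {(i, j). i < d \<and> j \<le> i} = (\<Sum>i<d. Suc i)" by simp
  also have "\<dots> = d * (d + 1) div 2"
    by (induction d) auto
  finally show ?thesis .
qed

section \<open>Lagrange interpolation at the first natural numbers\<close>

definition nodal :: "nat set \<Rightarrow> real poly" where
  "nodal J = (\<Prod>j\<in>J. [:- real j, 1:])"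

lemma poly_nodal: "poly (nodal J) x = (\<Prod>j\<in>J. x - real j)"
  by (simp add: nodal_def poly_prod)

lemma degree_nodal: "Polynomial.degree (nodal J) = card J"
  unfolding nodal_def by (subst degree_prod_sum_eq) auto

lemma coeff_nodal: "coeff (nodal J) (card J) = 1"
proof -
  have "lead_coeff (nodal J) = 1" unfolding nodal_def by (simp add: lead_coeff_prod)
  then show ?thesis by (simp add: degree_nodal)
qed

lemma poly_nodal_eq_0_iff: "finite J \<Longrightarrow> poly (nodal J) (real k) = 0 \<longleftrightarrow> k \<in> J"
  by (auto simp: poly_nodal)

definition lagrange_weight :: "nat \<Rightarrow> nat \<Rightarrow> real" where
  "lagrange_weight d i = inverse (\<Prod>j\<in>{..<d} - {i}. real i - real j)"

text \<open>Lagrange's formula at the nodes \<open>0, \<dots>, d-1\<close> determines a polynomial of degree less than \<open>d\<close>; the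
multiple \<open>l\<close> of the nodal polynomial makes the coefficient of degree \<open>d\<close> free as well. In this way
a polynomial of degree at most \<open>d\<close> is the same as \<open>d + 1\<close> independent numbers, the coordinates of a
linear functional on a space of dimension \<open>d + 1\<close>.\<close>

definition interpolant :: "nat \<Rightarrow> (nat \<Rightarrow> real) \<Rightarrow> real \<Rightarrow> real poly" where
  "interpolant d c l = smult l (nodal {..<d})
     + (\<Sum>i<d. smult (c i * lagrange_weight d i) (nodal ({..<d} - {i})))"

lemma poly_interpolant_node:
  assumes "k < d"
  shows "poly (interpolant d c l) (real k) = c k"
proof -
  have "(\<Sum>i<d. c i * lagrange_weight d i * poly (nodal ({..<d} - {i})) (real k))
      = (\<Sum>i<d. if i = k then c k else 0)"
  proof (rule sum.cong)
    fix i assume "i \<in> {..<d}"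
    show "c i * lagrange_weight d i * poly (nodal ({..<d} - {i})) (real k) = (if i = k then c k else 0)"
    proof (cases "i = k")
      case True
      have "(\<Prod>j\<in>{..<d} - {k}. real k - real j) \<noteq> 0" by simp
      then show ?thesis using True by (simp add: lagrange_weight_def poly_nodal)
    next
      case False
      then show ?thesis using assms by (simp add: poly_nodal_eq_0_iff)
    qed
  qed simp
  then show ?thesis
    using assms poly_nodal_eq_0_iff[of "{..<d}" k] by (simp add: interpolant_def poly_sum)
qed

lemma coeff_interpolant: "coeff (interpolant d c l) d = l"
proof -
  have "coeff (nodal ({..<d} - {i})) d = 0" if "i < d" for i
    using that by (intro coeff_eq_0) (simp add: degree_nodal)
  then show ?thesis
    using coeff_nodal[of "{..<d}"] by (simp add: interpolant_def coeff_sum)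
qed

lemma degree_interpolant: "Polynomial.degree (interpolant d c l) \<le> d"
  unfolding interpolant_def
  by (intro degree_add_le degree_sum_le order.trans[OF degree_smult_le])
    (auto simp: degree_nodal)

lemma poly_eq_0_of_many_zeros:
  fixes q :: "real poly"
  assumes "Polynomial.degree q \<le> d" "finite S" "d < card S" "\<And>k. k \<in> S \<Longrightarrow> poly q (real k) = 0"
  shows "q = 0"
proof (rule ccontr)
  assume "q \<noteq> 0"
  have "real ` S \<subseteq> {x. poly q x = 0}" using assms(4) by auto
  then have "card (real ` S) \<le> card {x. poly q x = 0}"
    using poly_roots_finite[OF \<open>q \<noteq> 0\<close>] by (rule card_mono[rotated])
  also have "\<dots> \<le> Polynomial.degree q"
    using \<open>q \<noteq> 0\<close> by (rule card_poly_roots_bound)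
  finally show False
    using assms(1,3) by (simp add: card_image)
qed

lemma interpolant_unique:
  fixes q :: "real poly"
  assumes "Polynomial.degree q \<le> d"
  shows "interpolant d (\<lambda>i. poly q (real i)) (coeff q d) = q"
proof -
  let ?r = "interpolant d (\<lambda>i. poly q (real i)) (coeff q d) - q"
  have "?r = 0"
  proof (rule ccontr)
    assume r: "?r \<noteq> 0"
    have "Polynomial.degree ?r \<le> d"
      using degree_interpolant assms by (rule degree_diff_le)
    moreover have "coeff ?r d = 0" by (simp add: coeff_interpolant)
    ultimately have less: "Polynomial.degree ?r < d"
      using r by (metis le_neq_implies_less leading_coeff_0_iff)
    then have "?r = 0"
      by (intro poly_eq_0_of_many_zeros[of ?r "Polynomial.degree ?r" "{..<d}"])
        (simp_all add: poly_interpolant_node)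
    then show False using r by simp
  qed
  then show ?thesis by simp
qed

section \<open>Homogeneous coordinates of a cyclic cluster\<close>

text \<open>The homogeneous vector of the \<open>k\<close>-th vertex of a cluster has the coordinates \<open>coord d k i\<close> for
\<open>i < d\<close> and a last coordinate \<open>cap d k\<close>. The indices \<open>k < d\<close> are the nodes, which are unit
vectors and span a facet. For \<open>k \<ge> d\<close> this is the point with parameter \<open>k\<close> of the moment curve in
the basis dual to interpolation, divided by the value of the nodal polynomial at \<open>k\<close>. The summand 2
comes from a projective transformation that moves the cap points towards the axis over the barycentre
of the nodes; it makes all their coordinates at least 1.\<close>

definition coord :: "nat \<Rightarrow> nat \<Rightarrow> nat \<Rightarrow> real" where
  "coord d k i = (if k < d then of_bool (k = i) else 2 + lagrange_weight d i / (real k - real i))"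

definition cap :: "nat \<Rightarrow> nat \<Rightarrow> real" where
  "cap d k = of_bool (d \<le> k)"

lemma sum_coord_node:
  assumes "k < d"
  shows "(\<Sum>i<d. c i * coord d k i) = c k"
proof -
  have "(\<Sum>i<d. c i * coord d k i) = (\<Sum>i<d. if i = k then c k else 0)"
    using assms by (intro sum.cong) (auto simp: coord_def)
  then show ?thesis using assms by simp
qed

text \<open>Division by the nodal polynomial turns Lagrange's formula into the partial fraction decomposition
\<open>q(k) / (\<Prod>j<d. k - j) = l + (\<Sum>i<d. q(i) * \<lambda>\<^sub>i / (k - i))\<close>,
where \<open>l\<close> is the coefficient of degree \<open>d\<close> and \<open>\<lambda>\<^sub>i\<close> are the Lagrange weights. Its right-hand
side is a linear functional of the homogeneous vector. The coefficient of the last coordinate makes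
up for the summand 2 in the other coordinates.\<close>

lemma cluster_functional:
  assumes "Polynomial.degree q \<le> d"
  shows "\<exists>w>0. (\<Sum>i<d. poly q (real i) * coord d k i) + (coeff q d - 2 * (\<Sum>i<d. poly q (real i))) * cap d k
    = w * poly q (real k)"
proof (cases "k < d")
  case True
  then show ?thesis
    by (intro exI[of _ 1]) (simp add: sum_coord_node cap_def)
next
  case False
  let ?N = "poly (nodal {..<d}) (real k)"
  have N: "?N > 0" unfolding poly_nodal using False by (intro prod_pos) auto
  have split: "?N = (real k - real i) * poly (nodal ({..<d} - {i})) (real k)" if "i < d" for i
    unfolding poly_nodal using that by (subst prod.remove[of _ i]) auto
  have "poly q (real k) = coeff q d * ?N
      + (\<Sum>i<d. poly q (real i) * lagrange_weight d i * poly (nodal ({..<d} - {i})) (real k))"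
    by (subst interpolant_unique[OF assms, symmetric], subst interpolant_def) (simp add: poly_sum)
  also have "(\<Sum>i<d. poly q (real i) * lagrange_weight d i * poly (nodal ({..<d} - {i})) (real k))
     = (\<Sum>i<d. poly q (real i) * (lagrange_weight d i / (real k - real i)) * ?N)"
  proof (rule sum.cong)
    fix i assume "i \<in> {..<d}"
    then have "i < d" "real k - real i \<noteq> 0" using False by auto
    then show "poly q (real i) * lagrange_weight d i * poly (nodal ({..<d} - {i})) (real k)
      = poly q (real i) * (lagrange_weight d i / (real k - real i)) * ?N"
      using split[of i] by simp
  qed simp
  also have "\<dots> = (\<Sum>i<d. poly q (real i) * (lagrange_weight d i / (real k - real i))) * ?N"
    by (simp add: sum_distrib_right)
  finally have "inverse ?N * poly q (real k)
      = coeff q d + (\<Sum>i<d. poly q (real i) * (lagrange_weight d i / (real k - real i)))"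
    using N by (simp add: field_simps)
  moreover have "(\<Sum>i<d. poly q (real i) * coord d k i)
      = 2 * (\<Sum>i<d. poly q (real i)) + (\<Sum>i<d. poly q (real i) * (lagrange_weight d i / (real k - real i)))"
    using False by (simp add: coord_def distrib_left sum.distrib sum_distrib_left mult.commute)
  ultimately show ?thesis
    using N False by (intro exI[of _ "inverse ?N"]) (simp add: cap_def)
qed

text \<open>The weight is the inverse of a product of nonzero integers.\<close>

lemma abs_lagrange_weight_le_1: "\<bar>lagrange_weight d i\<bar> \<le> 1"
proof -
  have "1 \<le> \<bar>\<Prod>j\<in>{..<d} - {i}. real i - real j\<bar>"
    unfolding abs_prod
  proof (rule prod_ge_1)
    fix j assume "j \<in> {..<d} - {i}"
    then have "1 \<le> \<bar>int i - int j\<bar>" by auto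
    then have "1 \<le> real_of_int \<bar>int i - int j\<bar>" by (simp only: of_int_1_le_iff)
    then show "1 \<le> \<bar>real i - real j\<bar>" by simp
  qed
  then show ?thesis
    by (simp add: lagrange_weight_def abs_inverse inverse_le_1_iff)
qed

lemma coord_nonneg: "i < d \<Longrightarrow> 0 \<le> coord d k i"
  and coord_ge_1: "i < d \<Longrightarrow> d \<le> k \<Longrightarrow> 1 \<le> coord d k i"
proof -
  show 1: "1 \<le> coord d k i" if "i < d" "d \<le> k" for i k
  proof -
    have "\<bar>lagrange_weight d i / (real k - real i)\<bar> \<le> 1"
    proof -
      have k: "1 \<le> \<bar>real k - real i\<bar>" using that by linarith
      then have "\<bar>lagrange_weight d i\<bar> \<le> \<bar>real k - real i\<bar>"
        using abs_lagrange_weight_le_1[of d i] by linarith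
      then show ?thesis using k by (simp add: abs_divide)
    qed
    then have "- 1 \<le> lagrange_weight d i / (real k - real i)" by linarith
    then show ?thesis using that unfolding coord_def by simp
  qed
  show "0 \<le> coord d k i" if "i < d"
  proof (cases "k < d")
    case True
    then show ?thesis by (simp add: coord_def)
  next
    case False
    then show ?thesis using 1[of i k] that by linarith
  qed
qed

lemma sum_coord_ge:
  assumes "\<And>i. i < d \<Longrightarrow> 0 \<le> c i" "d \<le> k"
  shows "(\<Sum>i<d. c i) \<le> (\<Sum>i<d. c i * coord d k i)"
proof (rule sum_mono)
  fix i assume "i \<in> {..<d}"
  then show "c i \<le> c i * coord d k i"
    using assms coord_ge_1[of i d k] mult_left_mono[of 1 "coord d k i" "c i"] by simp
qed

section \<open>Affine functions on the two clusters\<close>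

text \<open>The affine function \<open>x \<mapsto> a + \<Sum>i<d. \<beta> i * x\<^sub>i\<close> on \<open>d\<close>-space is linear in homogeneous coordinates
\<open>(X, s)\<close>, where it reads \<open>a s + \<Sum>i<d. \<beta> i * X\<^sub>i\<close>. Two linear embeddings of the cluster
\<open>(Y, h) = (coord d k, cap d k)\<close> into this space are used.

The low cluster has \<open>X = Y\<close> and \<open>s = (\<Sum>i<d. Y\<^sub>i) + h\<close>: its nodes are the unit vectors, and the
cap lies on the side of the origin. The high cluster has \<open>X\<^sub>i = Y\<^sub>i + \<Sum>j<d. j * Y\<^sub>j\<close> and
\<open>s = (\<Sum>i<d. Y\<^sub>i) / 2 - h\<close>: its nodes are twice the unit vectors, each shifted by a multiple of
\<open>(1, \<dots>, 1)\<close>, and the cap lies on the side away from the origin. Without the shift the nodes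
\<open>i, j\<close> of both clusters would lie in a plane; the different multiples break these quadrilaterals.

The values of the function at the two embedded vectors are as follows; \<open>a + \<beta> i\<close> and
\<open>a / 2 + \<beta> i + i * sum \<beta>\<close> are its values at the low and the high node \<open>i\<close>.\<close>

definition low_val :: "nat \<Rightarrow> real \<Rightarrow> (nat \<Rightarrow> real) \<Rightarrow> nat \<Rightarrow> real" where
  "low_val d a \<beta> k = (\<Sum>i<d. (a + \<beta> i) * coord d k i) + a * cap d k"

definition high_val :: "nat \<Rightarrow> real \<Rightarrow> (nat \<Rightarrow> real) \<Rightarrow> nat \<Rightarrow> real" where
  "high_val d a \<beta> k = (\<Sum>i<d. (a / 2 + \<beta> i + real i * sum \<beta> {..<d}) * coord d k i) - a * cap d k"

lemma low_val_node: "k < d \<Longrightarrow> low_val d a \<beta> k = a + \<beta> k"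
  by (simp add: low_val_def sum_coord_node cap_def)

lemma high_val_node: "k < d \<Longrightarrow> high_val d a \<beta> k = a / 2 + \<beta> k + real k * sum \<beta> {..<d}"
  by (simp add: high_val_def sum_coord_node cap_def)

lemma low_val_cap_ge:
  assumes "\<And>i. i < d \<Longrightarrow> 0 \<le> a + \<beta> i" "d \<le> k"
  shows "(\<Sum>i<d. a + \<beta> i) + a \<le> low_val d a \<beta> k"
  using sum_coord_ge[of d "\<lambda>i. a + \<beta> i" k] assms by (simp add: low_val_def cap_def)

lemma high_val_cap_ge:
  assumes "\<And>i. i < d \<Longrightarrow> 0 \<le> a / 2 + \<beta> i + real i * sum \<beta> {..<d}" "d \<le> k"
  shows "(\<Sum>i<d. a / 2 + \<beta> i + real i * sum \<beta> {..<d}) - a \<le> high_val d a \<beta> k"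
  using sum_coord_ge[of d "\<lambda>i. a / 2 + \<beta> i + real i * sum \<beta> {..<d}" k] assms
  by (simp add: high_val_def cap_def)

lemma sum_high_coeff:
  "(\<Sum>i<d. a / 2 + \<beta> i + real i * sum \<beta> {..<d})
    = real d * a / 2 + sum \<beta> {..<d} * (1 + (\<Sum>i<d. real i))"
proof -
  have "(\<Sum>i<d. real i * sum \<beta> {..<d}) = sum \<beta> {..<d} * (\<Sum>i<d. real i)"
    by (simp only: sum_distrib_right[symmetric] mult.commute)
  then show ?thesis by (simp add: sum.distrib distrib_left)
qed

lemma low_val_of_poly:
  assumes "Polynomial.degree q \<le> d"
    and "a = coeff q d - 2 * (\<Sum>i<d. poly q (real i))"
  shows "\<exists>w>0. low_val d a (\<lambda>i. poly q (real i) - a) k = w * poly q (real k)"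
  using cluster_functional[OF assms(1), of k] unfolding low_val_def assms(2) by simp

text \<open>The values at the high nodes depend on \<open>\<beta>\<close> also through the sum of \<open>\<beta>\<close>, which is found first by
adding up the \<open>d\<close> equations.\<close>

lemma high_functional_exists:
  obtains \<beta> where "\<And>i. i < d \<Longrightarrow> a / 2 + \<beta> i + real i * sum \<beta> {..<d} = c i"
proof
  define D where "D = (\<Sum>i<d. real i)"
  define B where "B = ((\<Sum>i<d. c i) - real d * a / 2) / (1 + D)"
  let ?\<beta> = "\<lambda>i. c i - a / 2 - real i * B"
  have "D \<ge> 0" unfolding D_def by (rule sum_nonneg) simp
  have "sum ?\<beta> {..<d} = (\<Sum>i<d. c i) - real d * a / 2 - D * B"
    by (simp add: sum_subtractf D_def sum_distrib_right)
  also have "\<dots> = B"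
    unfolding B_def using \<open>D \<ge> 0\<close> by (simp add: field_simps)
  finally show "a / 2 + ?\<beta> i + real i * sum ?\<beta> {..<d} = c i" for i by simp
qed

lemma high_val_of_poly:
  assumes "Polynomial.degree q \<le> d"
    and "a = 2 * (\<Sum>i<d. poly q (real i)) - coeff q d"
  obtains \<beta> where "\<And>i. i < d \<Longrightarrow> a / 2 + \<beta> i + real i * sum \<beta> {..<d} = poly q (real i)"
    and "\<And>k. \<exists>w>0. high_val d a \<beta> k = w * poly q (real k)"
proof -
  obtain \<beta> where \<beta>: "\<And>i. i < d \<Longrightarrow> a / 2 + \<beta> i + real i * sum \<beta> {..<d} = poly q (real i)"
    using high_functional_exists[of d a "\<lambda>i. poly q (real i)"] by blast
  have "\<exists>w>0. high_val d a \<beta> k = w * poly q (real k)" for k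
  proof -
    have "high_val d a \<beta> k = (\<Sum>i<d. poly q (real i) * coord d k i) + (- a) * cap d k"
      unfolding high_val_def using \<beta> by simp
    moreover have "- a = coeff q d - 2 * (\<Sum>i<d. poly q (real i))"
      using assms(2) by simp
    ultimately show ?thesis
      using cluster_functional[OF assms(1), of k] by simp
  qed
  then show ?thesis using that \<beta> by blast
qed

text \<open>The polynomial \<open>(x - u)\<^sup>2 (x - v)\<^sup>2\<close>; the case \<open>u = v\<close> will expose single vertices. The last two
inequalities fix the sign of the constant term \<open>a\<close> of the affine function: the coefficient of degree
\<open>d\<close> is at most 1, while among the integers \<open>0, 1, 2\<close> at least one is different from \<open>u\<close> and \<open>v\<close>
and contributes a positive integer to the sum.\<close>

lemma edge_polynomial:
  fixes u v d :: nat
  assumes "4 \<le> d"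
  obtains q where "Polynomial.degree q \<le> d" "\<And>x. 0 \<le> poly q x"
    "\<And>k. poly q (real k) = 0 \<longleftrightarrow> k = u \<or> k = v"
    "0 < (\<Sum>i<d. poly q (real i))" "coeff q d \<le> (\<Sum>i<d. poly q (real i))"
proof
  define q where "q = (nodal {u} * nodal {v})\<^sup>2"
  have poly_q: "poly q x = ((x - real u) * (x - real v))\<^sup>2" for x
    by (simp add: q_def poly_nodal)
  have "lead_coeff q = 1"
    by (simp add: q_def nodal_def lead_coeff_power lead_coeff_mult)
  have "q \<noteq> 0"
    using \<open>lead_coeff q = 1\<close> by auto
  have deg: "Polynomial.degree q = 4"
    by (simp add: q_def nodal_def degree_power_eq degree_mult_eq)
  show "Polynomial.degree q \<le> d" using deg assms by simp
  show nonneg: "0 \<le> poly q x" for x by (simp add: poly_q)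
  show "poly q (real k) = 0 \<longleftrightarrow> k = u \<or> k = v" for k by (simp add: poly_q)
  have "coeff q d \<le> 1"
    using \<open>lead_coeff q = 1\<close> deg assms coeff_eq_0[of q d] by (cases "d = 4") auto
  moreover have "1 \<le> (\<Sum>i<d. poly q (real i))"
  proof -
    have "\<not> {..<3} \<subseteq> {u, v}"
    proof
      assume "{..<3} \<subseteq> {u, v}"
      then have "card {..<3::nat} \<le> card {u, v}" by (intro card_mono) auto
      then show False using card_insert_le_m1[of 2 "{v}" u] by simp
    qed
    then obtain i where i: "i < 3" "i \<noteq> u" "i \<noteq> v" by blast
    have "1 \<le> \<bar>(int i - int u) * (int i - int v)\<bar>"
      using i by (simp only: int_one_le_iff_zero_less zero_less_abs_iff) simp
    then have "1 \<le> real_of_int \<bar>(int i - int u) * (int i - int v)\<bar>"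
      by (simp only: of_int_1_le_iff)
    then have "1 \<le> \<bar>(real i - real u) * (real i - real v)\<bar>" by simp
    then have "1 \<le> poly q (real i)" unfolding poly_q
      by (metis one_le_power power2_abs)
    also have "\<dots> \<le> (\<Sum>i<d. poly q (real i))"
      using i assms nonneg by (intro member_le_sum) auto
    finally show ?thesis .
  qed
  ultimately show "0 < (\<Sum>i<d. poly q (real i))" "coeff q d \<le> (\<Sum>i<d. poly q (real i))" by linarith+
qed

text \<open>The function given by the edge polynomial has \<open>a < 0\<close>. As it is nonnegative at the low nodes, this
makes all \<open>\<beta> i\<close> and all values at the high cluster positive.\<close>

lemma low_edge:
  assumes "4 \<le> d"
  obtains a \<beta> where "\<And>k. 0 \<le> low_val d a \<beta> k" "\<And>k. low_val d a \<beta> k = 0 \<longleftrightarrow> k = u \<or> k = v"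
    "\<And>k. 0 < high_val d a \<beta> k"
proof -
  obtain q where q: "Polynomial.degree q \<le> d" "\<And>x. 0 \<le> poly q x"
    "\<And>k. poly q (real k) = 0 \<longleftrightarrow> k = u \<or> k = v"
    "0 < (\<Sum>i<d. poly q (real i))" "coeff q d \<le> (\<Sum>i<d. poly q (real i))"
    by (rule edge_polynomial[OF assms, of u v]) (rule that)
  define a where "a = coeff q d - 2 * (\<Sum>i<d. poly q (real i))"
  define \<beta> where "\<beta> = (\<lambda>i. poly q (real i) - a)"
  have a: "a < 0" using q(4,5) by (simp add: a_def)
  have low: "\<exists>w>0. low_val d a \<beta> k = w * poly q (real k)" for k
    unfolding \<beta>_def by (rule low_val_of_poly[OF q(1) a_def])
  have B: "0 \<le> sum \<beta> {..<d}"
    unfolding \<beta>_def using q(2) a by (intro sum_nonneg) (simp add: add_nonneg_nonneg order.trans[of _ 0])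
  have C: "0 < a / 2 + \<beta> i + real i * sum \<beta> {..<d}" for i
  proof -
    have "0 \<le> real i * sum \<beta> {..<d}" using B by simp
    then show ?thesis using q(2)[of "real i"] a by (simp add: \<beta>_def)
  qed
  have "0 < high_val d a \<beta> k" for k
  proof (cases "k < d")
    case True
    then show ?thesis using C by (simp add: high_val_node)
  next
    case False
    have "0 \<le> (\<Sum>i<d. a / 2 + \<beta> i + real i * sum \<beta> {..<d})"
      using C by (intro sum_nonneg) (simp add: less_imp_le)
    then show ?thesis
      using high_val_cap_ge[of d a \<beta> k] C False a by (force simp: less_imp_le)
  qed
  moreover have "0 \<le> low_val d a \<beta> k" "low_val d a \<beta> k = 0 \<longleftrightarrow> k = u \<or> k = v" for k
    using low[of k] q(2,3) by auto
  ultimately show ?thesis using that by blast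
qed

text \<open>Here \<open>a\<close> is positive and at least the sum of the values at the high nodes. For \<open>d \<ge> 4\<close> this forces
\<open>sum \<beta>\<close> to be negative, so that every low node has a larger value than the high node with the same
index.\<close>

lemma high_edge:
  assumes "4 \<le> d"
  obtains a \<beta> where "\<And>k. 0 \<le> high_val d a \<beta> k" "\<And>k. high_val d a \<beta> k = 0 \<longleftrightarrow> k = u \<or> k = v"
    "\<And>k. 0 < low_val d a \<beta> k"
proof -
  obtain q where q: "Polynomial.degree q \<le> d" "\<And>x. 0 \<le> poly q x"
    "\<And>k. poly q (real k) = 0 \<longleftrightarrow> k = u \<or> k = v"
    "0 < (\<Sum>i<d. poly q (real i))" "coeff q d \<le> (\<Sum>i<d. poly q (real i))"
    by (rule edge_polynomial[OF assms, of u v]) (rule that)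
  define a where "a = 2 * (\<Sum>i<d. poly q (real i)) - coeff q d"
  obtain \<beta> where \<beta>: "\<And>i. i < d \<Longrightarrow> a / 2 + \<beta> i + real i * sum \<beta> {..<d} = poly q (real i)"
    and high: "\<And>k. \<exists>w>0. high_val d a \<beta> k = w * poly q (real k)"
    using high_val_of_poly[OF q(1) a_def] by blast
  have a: "0 < a" "(\<Sum>i<d. poly q (real i)) \<le> a" using q(4,5) by (simp_all add: a_def)
  define B where "B = sum \<beta> {..<d}"
  define D where "D = (\<Sum>i<d. real i)"
  have "D \<ge> 0" unfolding D_def by (rule sum_nonneg) simp
  have "(\<Sum>i<d. poly q (real i)) = real d * a / 2 + B * (1 + D)"
    using sum_high_coeff[of a \<beta> d] \<beta> by (simp add: B_def D_def)
  moreover have "4 * a \<le> real d * a" using a assms by (intro mult_right_mono) auto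
  ultimately have "B * (1 + D) < 0" using a by linarith
  then have B: "B < 0" using \<open>D \<ge> 0\<close> by (simp add: mult_less_0_iff)
  have A: "0 < a + \<beta> i" if "i < d" for i
  proof -
    have "real i * B \<le> 0" using B by (simp add: mult_nonneg_nonpos)
    then show ?thesis using \<beta>[OF that, folded B_def] q(2)[of "real i"] a by linarith
  qed
  have "0 < low_val d a \<beta> k" for k
  proof (cases "k < d")
    case True
    then show ?thesis using A by (simp add: low_val_node)
  next
    case False
    have "0 \<le> (\<Sum>i<d. a + \<beta> i)"
      using A by (intro sum_nonneg) (simp add: less_imp_le)
    then show ?thesis
      using low_val_cap_ge[of d a \<beta> k] A False a by (force simp: less_imp_le)
  qed
  moreover have "0 \<le> high_val d a \<beta> k" "high_val d a \<beta> k = 0 \<longleftrightarrow> k = u \<or> k = v" for k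
    using high[of k] q(2,3) by auto
  ultimately show ?thesis using that by blast
qed

text \<open>If the sum of \<open>\<beta>\<close> is normalised to 1, vanishing at the low node \<open>i\<close> and the high node \<open>j\<close> determines
\<open>\<beta> i\<close> and \<open>\<beta> j\<close> in terms of \<open>a\<close>. The value at the high node \<open>i\<close> is then \<open>i - a/2\<close> and that at the low
node \<open>j\<close> is \<open>a/2 - j\<close>, so \<open>a / 2\<close> is taken halfway between \<open>j\<close> and \<open>i\<close>. All other coordinates
of \<open>\<beta>\<close> share what is missing to the sum 1, which is positive. For \<open>i = j\<close> the two conditions on
\<open>\<beta> i\<close> coincide.\<close>

lemma crossing_edge:
  assumes "4 \<le> d" "i < d" "j \<le> i"
  obtains a \<beta> where "\<And>k. 0 \<le> low_val d a \<beta> k" "\<And>k. low_val d a \<beta> k = 0 \<longleftrightarrow> k = i"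
    "\<And>k. 0 \<le> high_val d a \<beta> k" "\<And>k. high_val d a \<beta> k = 0 \<longleftrightarrow> k = j"
proof -
  define a where "a = real i + real j"
  define R where "R = {..<d} - {i, j}"
  define t where "t = (if i = j then 1 + a else 1 + a + (a / 2 + real j)) / real (card R)"
  define \<beta> where "\<beta> = (\<lambda>k. if k = i then - a else if k = j then - (a / 2) - real j else t)"
  have j: "j < d" using assms by simp
  have "card {i, j} \<le> 2" by (simp add: card_insert_le_m1)
  then have "card R \<ge> 2" unfolding R_def using assms j by (subst card_Diff_subset) auto
  then have R: "real (card R) > 0" by simp
  have a: "a \<ge> 0" by (simp add: a_def)
  have t: "t > 0" unfolding t_def using R a by (auto intro!: divide_pos_pos add_pos_nonneg)
  have B: "sum \<beta> {..<d} = 1"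
  proof -
    have "sum \<beta> {..<d} = sum \<beta> {i, j} + sum \<beta> R"
      unfolding R_def using assms j by (subst sum.subset_diff[of "{i, j}"]) auto
    moreover have "sum \<beta> R = real (card R) * t"
      by (simp add: R_def \<beta>_def)
    moreover have "real (card R) * t = (if i = j then 1 + a else 1 + a + (a / 2 + real j))"
      unfolding t_def using R by simp
    ultimately show ?thesis by (auto simp: \<beta>_def)
  qed
  have A: "0 \<le> a + \<beta> k \<and> (a + \<beta> k = 0 \<longleftrightarrow> k = i)" for k
    using a t assms(3) by (auto simp: \<beta>_def a_def)
  have C: "0 \<le> a / 2 + \<beta> k + real k * 1 \<and> (a / 2 + \<beta> k + real k * 1 = 0 \<longleftrightarrow> k = j)" for k
  proof -
    consider "k = i" | "k = j" "k \<noteq> i" | "k \<noteq> i" "k \<noteq> j" by blast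
    then show ?thesis
    proof cases
      case 3
      then have "0 < a / 2 + \<beta> k + real k * 1"
        using a t by (simp add: \<beta>_def add_nonneg_pos add_pos_nonneg)
      then show ?thesis using 3 by simp
    qed (use assms(3) in \<open>auto simp: \<beta>_def a_def\<close>)
  qed
  have low_cap: "0 < low_val d a \<beta> k" if "d \<le> k" for k
  proof -
    have "(\<Sum>i<d. a + \<beta> i) = real d * a + 1" using B by (simp add: sum.distrib)
    then show ?thesis using low_val_cap_ge[of d a \<beta> k] that A a by (smt (verit) mult_nonneg_nonneg of_nat_0_le_iff)
  qed
  have high_cap: "0 < high_val d a \<beta> k" if "d \<le> k" for k
  proof -
    have "4 * a \<le> real d * a" using a assms by (intro mult_right_mono) auto
    moreover have "0 \<le> (\<Sum>i<d. real i)" by (rule sum_nonneg) simp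
    ultimately show ?thesis
      using high_val_cap_ge[of d a \<beta> k] sum_high_coeff[of a \<beta> d] that C a unfolding B by simp
  qed
  have "0 \<le> low_val d a \<beta> k \<and> (low_val d a \<beta> k = 0 \<longleftrightarrow> k = i)" for k
    using A[of k] low_cap[of k] assms by (cases "k < d") (auto simp: low_val_node)
  moreover have "0 \<le> high_val d a \<beta> k \<and> (high_val d a \<beta> k = 0 \<longleftrightarrow> k = j)" for k
    using C[of k] high_cap[of k] j B by (cases "k < d") (auto simp: high_val_node)
  ultimately show ?thesis using that by blast
qed

section \<open>Zero sets of supporting functionals\<close>

text \<open>A functional that is nonnegative at all vertices, seen through its values. The lemmas in this locale
show that it vanishes identically as soon as its zeros form one of the patterns that must not occur in
a proper face.\<close>

locale supporting_functional =
  fixes d n :: nat and a :: real and \<beta> :: "nat \<Rightarrow> real"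
  assumes d: "4 \<le> d" and n: "d < n"
    and low_nonneg: "\<And>k. k < n \<Longrightarrow> 0 \<le> low_val d a \<beta> k"
    and high_nonneg: "\<And>k. k < n \<Longrightarrow> 0 \<le> high_val d a \<beta> k"
begin

definition low_zeros :: "nat set" where
  "low_zeros = {k. k < n \<and> low_val d a \<beta> k = 0}"

definition high_zeros :: "nat set" where
  "high_zeros = {k. k < n \<and> high_val d a \<beta> k = 0}"

lemma low_node_nonneg: "i < d \<Longrightarrow> 0 \<le> a + \<beta> i"
  using low_nonneg[of i] n by (simp add: low_val_node)

lemma high_node_nonneg: "i < d \<Longrightarrow> 0 \<le> a / 2 + \<beta> i + real i * sum \<beta> {..<d}"
  using high_nonneg[of i] n by (simp add: high_val_node)

lemma sum_low_node: "(\<Sum>i<d. a + \<beta> i) = real d * a + sum \<beta> {..<d}"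
  by (simp add: sum.distrib)

lemma vanishes_if_low_nodes_vanish:
  assumes "a = 0" "sum \<beta> {..<d} = 0" "i < d"
  shows "\<beta> i = 0"
proof -
  have "\<forall>i\<in>{..<d}. \<beta> i = 0"
    using assms(1,2) low_node_nonneg by (subst sum_nonneg_eq_0_iff[symmetric]) auto
  then show ?thesis using assms(3) by simp
qed

text \<open>A segment from a low cap point to any high point crosses the simplex of the low nodes in its relative
interior, hence the interior of the polytope. In terms of values, a zero at a low cap point forces
\<open>a \<le> 0\<close>, and a zero at a high point forces \<open>a \<ge> 0\<close>.\<close>

lemma low_cap_vs_high:
  assumes "k \<in> low_zeros" "d \<le> k" "l \<in> high_zeros"
  shows "a = 0 \<and> (\<forall>i<d. \<beta> i = 0)"
proof -
  have S: "0 \<le> real d * a + sum \<beta> {..<d}"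
    unfolding sum_low_node[symmetric] using low_node_nonneg by (intro sum_nonneg) simp
  have le: "real d * a + sum \<beta> {..<d} + a \<le> 0"
    using low_val_cap_ge[of d a \<beta> k] assms low_node_nonneg
    unfolding sum_low_node by (simp add: low_zeros_def)
  then have "a \<le> 0" using S by linarith
  then have "real d * a \<le> 0" by (simp add: mult_nonneg_nonpos)
  then have B: "0 \<le> sum \<beta> {..<d}" using S by linarith
  have "a = 0"
  proof (cases "l < d")
    case True
    have "0 \<le> real l * sum \<beta> {..<d}" using B by simp
    moreover have "a / 2 + \<beta> l + real l * sum \<beta> {..<d} = 0"
      using assms(3) True by (simp add: high_zeros_def high_val_node)
    ultimately show ?thesis using low_node_nonneg[OF True] \<open>a \<le> 0\<close> by linarith
  next
    case False
    have "0 \<le> (\<Sum>i<d. a / 2 + \<beta> i + real i * sum \<beta> {..<d})"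
      using high_node_nonneg by (intro sum_nonneg) simp
    then show ?thesis
      using high_val_cap_ge[of d a \<beta> l] high_node_nonneg assms(3) False \<open>a \<le> 0\<close>
      by (simp add: high_zeros_def)
  qed
  moreover have "sum \<beta> {..<d} = 0" using le B calculation by simp
  ultimately show ?thesis using vanishes_if_low_nodes_vanish by blast
qed

text \<open>The same with the roles exchanged: now \<open>a \<ge> 0\<close>, hence \<open>sum \<beta> \<le> 0\<close>, and a low node vanishes only for
\<open>a = 0\<close>.\<close>

lemma high_cap_vs_low:
  assumes "l \<in> high_zeros" "d \<le> l" "k \<in> low_zeros"
  shows "a = 0 \<and> (\<forall>i<d. \<beta> i = 0)"
proof (cases "k < d")
  case False
  then show ?thesis using low_cap_vs_high assms by simp
next
  case True
  let ?B = "sum \<beta> {..<d}" and ?D = "\<Sum>i<d. real i"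
  have D: "0 \<le> ?D" by (rule sum_nonneg) simp
  have S: "0 \<le> real d * a / 2 + ?B * (1 + ?D)"
    unfolding sum_high_coeff[symmetric] using high_node_nonneg by (intro sum_nonneg) simp
  have le: "real d * a / 2 + ?B * (1 + ?D) \<le> a"
    using high_val_cap_ge[of d a \<beta> l] assms high_node_nonneg
    unfolding sum_high_coeff by (simp add: high_zeros_def)
  then have "0 \<le> a" using S by linarith
  then have da: "4 * a \<le> real d * a" using d by (intro mult_right_mono) auto
  then have "?B * (1 + ?D) \<le> 0" using le \<open>0 \<le> a\<close> by linarith
  then have B: "?B \<le> 0" using D by (simp add: mult_le_0_iff)
  then have "real k * ?B \<le> 0" by (simp add: mult_nonneg_nonpos)
  moreover have "a + \<beta> k = 0"
    using assms(3) True by (simp add: low_zeros_def low_val_node)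
  ultimately have "a = 0" using high_node_nonneg[OF True] \<open>0 \<le> a\<close> by linarith
  then have "0 \<le> ?B * (1 + ?D)" using S by simp
  then have "?B = 0" using B D by (simp add: zero_le_mult_iff)
  then show ?thesis using \<open>a = 0\<close> vanishes_if_low_nodes_vanish by blast
qed

text \<open>The diagonal from the low node \<open>i\<close> to the high node \<open>j\<close> with \<open>i < j\<close> is the one inside the polytope:
\<open>j * sum \<beta> \<le> a / 2 \<le> i * sum \<beta>\<close> follows from the signs at the opposite corners of the square.\<close>

lemma crossing_order:
  assumes "i \<in> low_zeros" "j \<in> high_zeros" "i < j" "j < d"
  shows "a = 0 \<and> (\<forall>i<d. \<beta> i = 0)"
proof -
  let ?B = "sum \<beta> {..<d}"
  have i: "a + \<beta> i = 0" and j: "a / 2 + \<beta> j + real j * ?B = 0"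
    using assms by (simp_all add: low_zeros_def high_zeros_def low_val_node high_val_node)
  have "a / 2 \<le> real i * ?B" using i high_node_nonneg[of i] assms by simp
  moreover have "real j * ?B \<le> a / 2" using j low_node_nonneg[of j] assms by simp
  ultimately have "real j * ?B \<le> real i * ?B" by linarith
  then have B: "?B \<le> 0" using assms(3) by (simp add: mult_le_cancel_right)
  have "real i * ?B \<le> 0" using B by (simp add: mult_nonneg_nonpos)
  then have "a \<le> 0" using \<open>a / 2 \<le> real i * ?B\<close> by linarith
  have "0 \<le> real d * a + ?B"
    unfolding sum_low_node[symmetric] using low_node_nonneg by (intro sum_nonneg) simp
  moreover have "real d * a \<le> 0" using \<open>a \<le> 0\<close> by (simp add: mult_nonneg_nonpos)
  ultimately have "?B = 0" using B by linarith
  moreover have "a = 0" using \<open>real j * ?B \<le> a / 2\<close> \<open>a \<le> 0\<close> calculation by simp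
  ultimately show ?thesis using vanishes_if_low_nodes_vanish by blast
qed

text \<open>A set of nodes from both ends that uses every index spans a simplex that passes through the interior
of the neck. Every \<open>\<beta> k\<close> is then one of two expressions in \<open>a\<close> and \<open>sum \<beta>\<close>, and the sign of
their sum contradicts the sign of \<open>sum \<beta>\<close> unless both \<open>a\<close> and \<open>sum \<beta>\<close> are zero.\<close>

lemma missing_index:
  assumes "i \<in> low_zeros" "i < d" "j \<in> high_zeros" "j < d" "{..<d} \<subseteq> low_zeros \<union> high_zeros"
  shows "a = 0 \<and> (\<forall>i<d. \<beta> i = 0)"
proof -
  let ?B = "sum \<beta> {..<d}"
  have low: "\<beta> k = - a" if "k \<in> low_zeros" "k < d" for k
    using that by (simp add: low_zeros_def low_val_node)
  have high: "\<beta> k = - (a / 2) - real k * ?B" if "k \<in> high_zeros" "k < d" for k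
    using that by (simp add: high_zeros_def high_val_node)
  have i: "a / 2 \<le> real i * ?B" using low[OF assms(1,2)] high_node_nonneg[OF assms(2)] by simp
  have j: "real j * ?B \<le> a / 2" using high[OF assms(3,4)] low_node_nonneg[OF assms(4)] by simp
  have \<beta>: "\<beta> k = - a \<or> \<beta> k = - (a / 2) - real k * ?B" if "k < d" for k
    using that low high assms(5) by blast
  have "a = 0 \<and> ?B = 0"
  proof (cases "0 \<le> a")
    case True
    have B: "0 \<le> ?B"
    proof (rule ccontr)
      assume neg: "\<not> 0 \<le> ?B"
      then have "real i * ?B \<le> 0" by (simp add: mult_nonneg_nonpos)
      then have "a = 0" using i True by linarith
      have "0 \<le> ?B"
      proof (rule sum_nonneg)
        fix k assume "k \<in> {..<d}"
        then show "0 \<le> \<beta> k"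
          using \<beta>[of k] \<open>a = 0\<close> neg by (auto simp: mult_nonneg_nonpos)
      qed
      then show False using neg by simp
    qed
    have "?B \<le> 0"
    proof (rule sum_nonpos)
      fix k assume "k \<in> {..<d}"
      moreover have "0 \<le> real k * ?B" using B by simp
      ultimately show "\<beta> k \<le> 0" using \<beta>[of k] True by auto
    qed
    then have "?B = 0" using B by simp
    then show ?thesis using i True by simp
  next
    case False
    then have "real j * ?B < 0" using j by linarith
    then have B: "?B < 0" by (simp add: mult_less_0_iff)
    have "0 \<le> ?B"
    proof (rule sum_nonneg)
      fix k assume "k \<in> {..<d}"
      moreover have "real k * ?B \<le> 0" using B by (simp add: mult_nonneg_nonpos)
      ultimately show "0 \<le> \<beta> k" using \<beta>[of k] False by auto
    qed
    then show ?thesis using B by simp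
  qed
  then show ?thesis using vanishes_if_low_nodes_vanish by blast
qed

end

section \<open>Separating the zeros of a supporting functional\<close>

text \<open>If \<open>r\<close> is the index of no zero, \<open>\<beta> r\<close> can be used to cancel the sum of \<open>\<beta>\<close>, and then the
shift of the high nodes does not matter.\<close>

lemma balanced_functional:
  assumes "r < d"
  obtains \<beta> where "\<And>k. k < d \<Longrightarrow> k \<noteq> r \<Longrightarrow> low_val d a \<beta> k = a + \<gamma> k"
    and "\<And>k. k < d \<Longrightarrow> k \<noteq> r \<Longrightarrow> high_val d a \<beta> k = a / 2 + \<gamma> k"
proof
  let ?\<beta> = "\<lambda>k. if k = r then - (\<Sum>i\<in>{..<d} - {r}. \<gamma> i) else \<gamma> k"
  have "sum ?\<beta> {..<d} = 0"
    using assms by (subst sum.remove[of _ r]) auto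
  then show "low_val d a ?\<beta> k = a + \<gamma> k" "high_val d a ?\<beta> k = a / 2 + \<gamma> k" if "k < d" "k \<noteq> r" for k
    using that by (simp_all add: low_val_node high_val_node)
qed

text \<open>The points of a cluster are in general position, since a nonzero polynomial of degree at most \<open>d\<close> has
at most \<open>d\<close> roots.\<close>

lemma many_low_zeros:
  assumes "finite S" "d < card S" "\<And>k. k \<in> S \<Longrightarrow> low_val d a \<beta> k = 0"
  shows "a = 0 \<and> (\<forall>i<d. \<beta> i = 0)"
proof -
  define q where "q = interpolant d (\<lambda>i. a + \<beta> i) (a + 2 * (\<Sum>i<d. a + \<beta> i))"
  have deg: "Polynomial.degree q \<le> d" unfolding q_def by (rule degree_interpolant)
  have node: "poly q (real i) = a + \<beta> i" if "i < d" for i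
    unfolding q_def using that by (rule poly_interpolant_node)
  have coeff: "coeff q d = a + 2 * (\<Sum>i<d. a + \<beta> i)"
    unfolding q_def by (rule coeff_interpolant)
  have "\<exists>w>0. low_val d a \<beta> k = w * poly q (real k)" for k
    using cluster_functional[OF deg, of k] by (simp add: node coeff low_val_def)
  then have "poly q (real k) = 0" if "k \<in> S" for k
    using assms(3)[OF that] by (metis mult_eq_0_iff less_irrefl)
  then have "q = 0" using poly_eq_0_of_many_zeros deg assms by blast
  then have A: "a + \<beta> i = 0" if "i < d" for i using node[OF that] by simp
  then have "a = 0" using coeff \<open>q = 0\<close> by simp
  then show ?thesis using A by simp
qed

text \<open>The two embeddings differ by a linear bijection and a sign of the last coordinate, which reduces the
claim to the low cluster.\<close>

lemma many_high_zeros: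
  assumes "finite S" "d < card S" "\<And>k. k \<in> S \<Longrightarrow> high_val d a \<beta> k = 0"
  shows "a = 0 \<and> (\<forall>i<d. \<beta> i = 0)"
proof -
  let ?C = "\<lambda>i. a / 2 + \<beta> i + real i * sum \<beta> {..<d}"
  have eq: "high_val d a \<beta> k = low_val d (- a) (\<lambda>i. ?C i + a) k" for k
    by (simp add: high_val_def low_val_def add.assoc)
  have zero: "- a = 0 \<and> (\<forall>i<d. ?C i + a = 0)"
    by (rule many_low_zeros[OF assms(1,2)]) (simp only: eq[symmetric] assms(3))
  have a0: "a = 0" using zero by linarith
  have C0: "?C i = 0" if "i < d" for i
  proof -
    have "?C i + a = 0" using zero that by blast
    then show ?thesis using a0 by linarith
  qed
  have "(\<Sum>i<d. ?C i) = 0" using C0 by (intro sum.neutral) blast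
  then have "sum \<beta> {..<d} * (1 + (\<Sum>i<d. real i)) = 0"
    unfolding sum_high_coeff a0 by simp
  moreover have "0 \<le> (\<Sum>i<d. real i)" by (rule sum_nonneg) simp
  ultimately have B0: "sum \<beta> {..<d} = 0"
    unfolding mult_eq_0_iff by linarith
  have "\<beta> i = 0" if "i < d" for i
    using C0[OF that] unfolding a0 B0 by simp
  then show ?thesis using a0 by blast
qed

text \<open>The nodal polynomial of the other zeros has degree less than \<open>d\<close>.\<close>

lemma low_separation:
  assumes "finite S" "card S \<le> d" "s \<in> S"
  obtains a \<beta> where "low_val d a \<beta> s \<noteq> 0" "\<And>k. k \<in> S \<Longrightarrow> k \<noteq> s \<Longrightarrow> low_val d a \<beta> k = 0"
proof -
  define q where "q = nodal (S - {s})"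
  have deg: "Polynomial.degree q \<le> d"
    using assms by (simp add: q_def degree_nodal card_Diff_subset)
  define a where "a = coeff q d - 2 * (\<Sum>i<d. poly q (real i))"
  define \<beta> where "\<beta> = (\<lambda>i. poly q (real i) - a)"
  have "\<exists>w>0. low_val d a \<beta> k = w * poly q (real k)" for k
    unfolding \<beta>_def by (rule low_val_of_poly[OF deg a_def])
  then have "low_val d a \<beta> k = 0 \<longleftrightarrow> k \<in> S - {s}" for k
    using poly_nodal_eq_0_iff[of "S - {s}" k] assms(1) unfolding q_def
    by (metis finite_Diff mult_eq_0_iff less_irrefl)
  then show ?thesis using that by blast
qed

lemma high_separation:
  assumes "finite S" "card S \<le> d" "s \<in> S"
  obtains a \<beta> where "high_val d a \<beta> s \<noteq> 0" "\<And>k. k \<in> S \<Longrightarrow> k \<noteq> s \<Longrightarrow> high_val d a \<beta> k = 0"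
proof -
  define q where "q = nodal (S - {s})"
  have deg: "Polynomial.degree q \<le> d"
    using assms by (simp add: q_def degree_nodal card_Diff_subset)
  define a where "a = 2 * (\<Sum>i<d. poly q (real i)) - coeff q d"
  obtain \<beta> where "\<And>k. \<exists>w>0. high_val d a \<beta> k = w * poly q (real k)"
    using high_val_of_poly[OF deg a_def] by blast
  then have "high_val d a \<beta> k = 0 \<longleftrightarrow> k \<in> S - {s}" for k
    using poly_nodal_eq_0_iff[of "S - {s}" k] assms(1) unfolding q_def
    by (metis finite_Diff mult_eq_0_iff less_irrefl)
  then show ?thesis using that by blast
qed

context supporting_functional
begin

context
  assumes nonzero: "\<not> (a = 0 \<and> (\<forall>i<d. \<beta> i = 0))"
begin

lemma zeros_crossing:
  assumes "i \<in> low_zeros" "j \<in> high_zeros"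
  shows "i < d" "j < d" "j \<le> i"
proof -
  show "i < d" using low_cap_vs_high assms nonzero by (meson not_less)
  show "j < d" using high_cap_vs_low assms nonzero by (meson not_less)
  then show "j \<le> i" using crossing_order assms nonzero by (meson not_less)
qed

lemma finite_zeros: "finite low_zeros" "finite high_zeros"
  unfolding low_zeros_def high_zeros_def by simp_all

lemma card_zeros: "card low_zeros \<le> d" "card high_zeros \<le> d"
proof -
  show "card low_zeros \<le> d"
    using many_low_zeros[OF finite_zeros(1), of d a \<beta>] nonzero
    unfolding low_zeros_def by (metis (mono_tags, lifting) mem_Collect_eq not_less)
  show "card high_zeros \<le> d"
    using many_high_zeros[OF finite_zeros(2), of d a \<beta>] nonzero
    unfolding high_zeros_def by (metis (mono_tags, lifting) mem_Collect_eq not_less)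
qed

lemma unused_index:
  assumes "i \<in> low_zeros" "j \<in> high_zeros"
  obtains r where "r < d" "r \<notin> low_zeros" "r \<notin> high_zeros"
  using missing_index[OF assms(1) zeros_crossing(1)[OF assms] assms(2) zeros_crossing(2)[OF assms]] nonzero
  by blast

text \<open>A zero set inside one cluster is separated by polynomials. A zero set that meets both consists of nodes
and misses an index \<open>r\<close>; then a balanced functional separates \<open>s\<close>. If \<open>s\<close> occurs on one side only,
\<open>a = 0\<close> and a unit vector suffice. If both nodes with index \<open>s\<close> are zeros, \<open>a = 1\<close> tells them
apart. By \<open>zeros_crossing\<close> no other index occurs on both sides, so the values at all
further zeros can be set to 0.\<close>

lemma low_zero_separation:
  assumes s: "s \<in> low_zeros"
  obtains a' \<beta>' where "low_val d a' \<beta>' s \<noteq> 0"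
    "\<And>k. k \<in> low_zeros \<Longrightarrow> k \<noteq> s \<Longrightarrow> low_val d a' \<beta>' k = 0"
    "\<And>k. k \<in> high_zeros \<Longrightarrow> high_val d a' \<beta>' k = 0"
proof (cases "high_zeros = {}")
  case True
  then show ?thesis using low_separation[OF finite_zeros(1) card_zeros(1) s] that by blast
next
  case False
  then obtain j where j: "j \<in> high_zeros" by blast
  then obtain r where r: "r < d" "r \<notin> low_zeros" "r \<notin> high_zeros"
    using unused_index s by blast
  have low_d: "k < d" "k \<noteq> r" if "k \<in> low_zeros" for k using zeros_crossing that j r by auto
  have high_d: "k < d" "k \<noteq> r" if "k \<in> high_zeros" for k using zeros_crossing that s r by auto
  show ?thesis
  proof (cases "s \<in> high_zeros")
    case True
    have disj: "k \<notin> high_zeros" if "k \<in> low_zeros" "k \<noteq> s" for k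
      using zeros_crossing[OF that(1) True] zeros_crossing[OF s, of k] that by auto
    obtain \<beta>' where "\<And>k. k < d \<Longrightarrow> k \<noteq> r \<Longrightarrow>
        low_val d 1 \<beta>' k = 1 + (if k \<in> high_zeros then - 1 / 2 else - 1)"
      "\<And>k. k < d \<Longrightarrow> k \<noteq> r \<Longrightarrow>
        high_val d 1 \<beta>' k = 1 / 2 + (if k \<in> high_zeros then - 1 / 2 else - 1)"
      using balanced_functional[OF r(1), of 1 "\<lambda>k. if k \<in> high_zeros then - 1 / 2 else - 1"] by blast
    then show ?thesis using that[of 1 \<beta>'] low_d high_d s True disj by simp
  next
    case False
    obtain \<beta>' where "\<And>k. k < d \<Longrightarrow> k \<noteq> r \<Longrightarrow> low_val d 0 \<beta>' k = 0 + of_bool (k = s)"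
      "\<And>k. k < d \<Longrightarrow> k \<noteq> r \<Longrightarrow> high_val d 0 \<beta>' k = 0 / 2 + of_bool (k = s)"
      using balanced_functional[OF r(1), of 0 "\<lambda>k. of_bool (k = s)"] by blast
    then show ?thesis using that[of 0 \<beta>'] low_d high_d s False by auto
  qed
qed

lemma high_zero_separation:
  assumes s: "s \<in> high_zeros"
  obtains a' \<beta>' where "high_val d a' \<beta>' s \<noteq> 0"
    "\<And>k. k \<in> high_zeros \<Longrightarrow> k \<noteq> s \<Longrightarrow> high_val d a' \<beta>' k = 0"
    "\<And>k. k \<in> low_zeros \<Longrightarrow> low_val d a' \<beta>' k = 0"
proof (cases "low_zeros = {}")
  case True
  then show ?thesis using high_separation[OF finite_zeros(2) card_zeros(2) s] that by blast
next
  case False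
  then obtain i where i: "i \<in> low_zeros" by blast
  then obtain r where r: "r < d" "r \<notin> low_zeros" "r \<notin> high_zeros"
    using unused_index s by blast
  have low_d: "k < d" "k \<noteq> r" if "k \<in> low_zeros" for k using zeros_crossing that s r by auto
  have high_d: "k < d" "k \<noteq> r" if "k \<in> high_zeros" for k using zeros_crossing that i r by auto
  show ?thesis
  proof (cases "s \<in> low_zeros")
    case True
    have disj: "k \<notin> low_zeros" if "k \<in> high_zeros" "k \<noteq> s" for k
      using zeros_crossing[OF True that(1)] zeros_crossing[OF _ s, of k] that by auto
    obtain \<beta>' where "\<And>k. k < d \<Longrightarrow> k \<noteq> r \<Longrightarrow>
        low_val d 1 \<beta>' k = 1 + (if k \<in> low_zeros then - 1 else - 1 / 2)"
      "\<And>k. k < d \<Longrightarrow> k \<noteq> r \<Longrightarrow>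
        high_val d 1 \<beta>' k = 1 / 2 + (if k \<in> low_zeros then - 1 else - 1 / 2)"
      using balanced_functional[OF r(1), of 1 "\<lambda>k. if k \<in> low_zeros then - 1 else - 1 / 2"] by blast
    then show ?thesis using that[of 1 \<beta>'] low_d high_d s True disj by simp
  next
    case False
    obtain \<beta>' where "\<And>k. k < d \<Longrightarrow> k \<noteq> r \<Longrightarrow> low_val d 0 \<beta>' k = 0 + of_bool (k = s)"
      "\<And>k. k < d \<Longrightarrow> k \<noteq> r \<Longrightarrow> high_val d 0 \<beta>' k = 0 / 2 + of_bool (k = s)"
      using balanced_functional[OF r(1), of 0 "\<lambda>k. of_bool (k = s)"] by blast
    then show ?thesis using that[of 0 \<beta>'] low_d high_d s False by auto
  qed
qed

end
end

section \<open>The polytope\<close>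

text \<open>The homogenising coordinates \<open>s\<close> of the two clusters. They are positive, so the points below exist and
the values of an affine function at them have the signs of \<open>low_val\<close> and \<open>high_val\<close>.\<close>

definition low_scale :: "nat \<Rightarrow> nat \<Rightarrow> real" where
  "low_scale d k = (\<Sum>i<d. coord d k i) + cap d k"

definition high_scale :: "nat \<Rightarrow> nat \<Rightarrow> real" where
  "high_scale d k = (\<Sum>i<d. coord d k i) / 2 - cap d k"

lemma low_scale_pos:
  assumes "0 < d"
  shows "0 < low_scale d k"
proof -
  have "0 \<le> (\<Sum>i<d. coord d k i)" by (intro sum_nonneg coord_nonneg) simp
  then show ?thesis
    using sum_coord_node[of k d "\<lambda>_. 1"] by (cases "k < d") (simp_all add: low_scale_def cap_def)
qed

lemma high_scale_pos:
  assumes "3 \<le> d"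
  shows "0 < high_scale d k"
proof (cases "k < d")
  case True
  then show ?thesis using sum_coord_node[of k d "\<lambda>_. 1"] by (simp add: high_scale_def cap_def)
next
  case False
  then have "real d \<le> (\<Sum>i<d. coord d k i)"
    using sum_coord_ge[of d "\<lambda>_. 1" k] by simp
  then show ?thesis using False assms by (simp add: high_scale_def cap_def)
qed

locale two_clusters =
  fixes d n :: nat and bs :: "nat \<Rightarrow> 'a::euclidean_space"
  assumes d: "4 \<le> d" and n: "d < n" and bs: "bij_betw bs {..<d} Basis"
begin

definition low_pt :: "nat \<Rightarrow> 'a" where
  "low_pt k = (\<Sum>i<d. (coord d k i / low_scale d k) *\<^sub>R bs i)"

definition high_pt :: "nat \<Rightarrow> 'a" where
  "high_pt k = (\<Sum>i<d. ((coord d k i + (\<Sum>j<d. real j * coord d k j)) / high_scale d k) *\<^sub>R bs i)"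

lemma affine_low_pt: "a + b \<bullet> low_pt k = low_val d a (\<lambda>i. b \<bullet> bs i) k / low_scale d k"
proof -
  have pos: "low_scale d k > 0" using low_scale_pos d by simp
  have "b \<bullet> low_pt k = (\<Sum>i<d. (b \<bullet> bs i) * coord d k i) / low_scale d k"
    by (simp add: low_pt_def inner_sum_right sum_divide_distrib mult.commute)
  moreover have "low_val d a (\<lambda>i. b \<bullet> bs i) k = a * low_scale d k + (\<Sum>i<d. (b \<bullet> bs i) * coord d k i)"
    by (simp add: low_val_def low_scale_def distrib_right distrib_left sum.distrib sum_distrib_left)
  ultimately show ?thesis using pos by (simp add: field_simps)
qed

lemma affine_high_pt: "a + b \<bullet> high_pt k = high_val d a (\<lambda>i. b \<bullet> bs i) k / high_scale d k"
proof -
  let ?\<beta> = "\<lambda>i. b \<bullet> bs i"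
  let ?M = "\<Sum>j<d. real j * coord d k j"
  have pos: "high_scale d k > 0" using high_scale_pos d by simp
  have "b \<bullet> high_pt k = (\<Sum>i<d. ?\<beta> i * (coord d k i + ?M)) / high_scale d k"
    by (simp add: high_pt_def inner_sum_right sum_divide_distrib mult.commute)
  also have "(\<Sum>i<d. ?\<beta> i * (coord d k i + ?M)) = (\<Sum>i<d. ?\<beta> i * coord d k i) + sum ?\<beta> {..<d} * ?M"
    by (simp only: distrib_left sum.distrib sum_distrib_right[symmetric])
  finally have inner: "b \<bullet> high_pt k = \<dots> / high_scale d k" .
  have "high_val d a ?\<beta> k = (\<Sum>i<d. a / 2 * coord d k i) + (\<Sum>i<d. ?\<beta> i * coord d k i)
      + (\<Sum>i<d. sum ?\<beta> {..<d} * (real i * coord d k i)) - a * cap d k"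
    unfolding high_val_def sum.distrib[symmetric] by (simp only: distrib_right mult.assoc mult.left_commute)
  also have "\<dots> = a * high_scale d k + ((\<Sum>i<d. ?\<beta> i * coord d k i) + sum ?\<beta> {..<d} * ?M)"
    unfolding sum_distrib_left[symmetric] high_scale_def by (simp add: algebra_simps)
  finally show ?thesis using pos inner by (simp add: field_simps)
qed

lemma functional_realized:
  obtains b where "\<And>k. a + b \<bullet> low_pt k = low_val d a \<beta> k / low_scale d k"
    "\<And>k. a + b \<bullet> high_pt k = high_val d a \<beta> k / high_scale d k"
proof -
  define b where "b = (\<Sum>i<d. \<beta> i *\<^sub>R bs i)"
  have b: "b \<bullet> bs i = \<beta> i" if "i < d" for i
  proof -
    have "b \<bullet> bs i = (\<Sum>j<d. if j = i then \<beta> i else 0)"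
      unfolding b_def inner_sum_left
    proof (rule sum.cong)
      fix j assume "j \<in> {..<d}"
      then have "bs j \<in> Basis" "bs i \<in> Basis" "bs j = bs i \<longleftrightarrow> j = i"
        using bs that by (auto simp: bij_betw_def inj_on_def)
      then show "\<beta> j *\<^sub>R bs j \<bullet> bs i = (if j = i then \<beta> i else 0)"
        by (simp add: inner_Basis)
    qed simp
    then show ?thesis using that by simp
  qed
  then have "low_val d a (\<lambda>i. b \<bullet> bs i) k = low_val d a \<beta> k"
    "high_val d a (\<lambda>i. b \<bullet> bs i) k = high_val d a \<beta> k" for k
    by (simp_all add: low_val_def high_val_def)
  then show ?thesis using that affine_low_pt affine_high_pt by metis
qed

definition low_pts :: "'a set" where "low_pts = low_pt ` {..<n}"
definition high_pts :: "'a set" where "high_pts = high_pt ` {..<n}"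
definition body :: "'a set" where "body = convex hull (low_pts \<union> high_pts)"

lemma scale_pos: "0 < low_scale d k" "0 < high_scale d k"
  using low_scale_pos high_scale_pos d by simp_all

lemma low_pair_exposed:
  obtains a b where "\<And>k. 0 \<le> a + b \<bullet> low_pt k" "\<And>k. a + b \<bullet> low_pt k = 0 \<longleftrightarrow> k = u \<or> k = v"
    "\<And>k. 0 < a + b \<bullet> high_pt k"
proof -
  obtain a \<beta> where L: "\<And>k. 0 \<le> low_val d a \<beta> k" "\<And>k. low_val d a \<beta> k = 0 \<longleftrightarrow> k = u \<or> k = v"
    "\<And>k. 0 < high_val d a \<beta> k"
    by (rule low_edge[OF d, of u v]) (rule that)
  obtain b where "\<And>k. a + b \<bullet> low_pt k = low_val d a \<beta> k / low_scale d k"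
    "\<And>k. a + b \<bullet> high_pt k = high_val d a \<beta> k / high_scale d k"
    by (rule functional_realized[of a \<beta>]) (rule that)
  then show ?thesis using that[of a b] L scale_pos by (simp add: less_imp_le less_imp_neq[symmetric])
qed

lemma high_pair_exposed:
  obtains a b where "\<And>k. 0 \<le> a + b \<bullet> high_pt k" "\<And>k. a + b \<bullet> high_pt k = 0 \<longleftrightarrow> k = u \<or> k = v"
    "\<And>k. 0 < a + b \<bullet> low_pt k"
proof -
  obtain a \<beta> where L: "\<And>k. 0 \<le> high_val d a \<beta> k" "\<And>k. high_val d a \<beta> k = 0 \<longleftrightarrow> k = u \<or> k = v"
    "\<And>k. 0 < low_val d a \<beta> k"
    by (rule high_edge[OF d, of u v]) (rule that)
  obtain b where "\<And>k. a + b \<bullet> low_pt k = low_val d a \<beta> k / low_scale d k"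
    "\<And>k. a + b \<bullet> high_pt k = high_val d a \<beta> k / high_scale d k"
    by (rule functional_realized[of a \<beta>]) (rule that)
  then show ?thesis using that[of a b] L scale_pos by (simp add: less_imp_le less_imp_neq[symmetric])
qed

lemma crossing_pair_exposed:
  assumes "i < d" "j \<le> i"
  obtains a b where "\<And>k. 0 \<le> a + b \<bullet> low_pt k" "\<And>k. a + b \<bullet> low_pt k = 0 \<longleftrightarrow> k = i"
    "\<And>k. 0 \<le> a + b \<bullet> high_pt k" "\<And>k. a + b \<bullet> high_pt k = 0 \<longleftrightarrow> k = j"
proof -
  obtain a \<beta> where L: "\<And>k. 0 \<le> low_val d a \<beta> k" "\<And>k. low_val d a \<beta> k = 0 \<longleftrightarrow> k = i"
    "\<And>k. 0 \<le> high_val d a \<beta> k" "\<And>k. high_val d a \<beta> k = 0 \<longleftrightarrow> k = j"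
    by (rule crossing_edge[OF d assms]) (rule that)
  obtain b where "\<And>k. a + b \<bullet> low_pt k = low_val d a \<beta> k / low_scale d k"
    "\<And>k. a + b \<bullet> high_pt k = high_val d a \<beta> k / high_scale d k"
    by (rule functional_realized[of a \<beta>]) (rule that)
  then show ?thesis using that[of a b] L scale_pos by (simp add: less_imp_le less_imp_neq[symmetric])
qed

lemma inj_low_pt: "inj low_pt"
proof (rule injI)
  fix u v assume "low_pt u = low_pt v"
  then show "u = v" using low_pair_exposed[of u u] by metis
qed

lemma inj_high_pt: "inj high_pt"
proof (rule injI)
  fix u v assume "high_pt u = high_pt v"
  then show "u = v" using high_pair_exposed[of u u] by metis
qed

lemma low_pt_neq_high_pt: "low_pt u \<noteq> high_pt v"
  using low_pair_exposed[of u u] by (metis less_irrefl)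

lemma finite_pts: "finite low_pts" "finite high_pts" "finite (low_pts \<union> high_pts)"
  by (simp_all add: low_pts_def high_pts_def)

lemma supporting:
  assumes "\<And>x. x \<in> low_pts \<union> high_pts \<Longrightarrow> 0 \<le> a + b \<bullet> x"
  shows "supporting_functional d n a (\<lambda>i. b \<bullet> bs i)"
proof (unfold_locales)
  fix k assume "k < n"
  then have "0 \<le> a + b \<bullet> low_pt k" "0 \<le> a + b \<bullet> high_pt k"
    using assms by (auto simp: low_pts_def high_pts_def)
  then show "0 \<le> low_val d a (\<lambda>i. b \<bullet> bs i) k" "0 \<le> high_val d a (\<lambda>i. b \<bullet> bs i) k"
    using scale_pos[of k] unfolding affine_low_pt affine_high_pt by (simp_all add: zero_le_divide_iff)
qed (fact d n)+

lemma zeros_iff: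
  "a + b \<bullet> low_pt k = 0 \<longleftrightarrow> low_val d a (\<lambda>i. b \<bullet> bs i) k = 0"
  "a + b \<bullet> high_pt k = 0 \<longleftrightarrow> high_val d a (\<lambda>i. b \<bullet> bs i) k = 0"
  using scale_pos[of k] unfolding affine_low_pt affine_high_pt by auto

lemma vanishing_functional:
  assumes "a = 0 \<and> (\<forall>i<d. b \<bullet> bs i = 0)" "x \<in> low_pts \<union> high_pts"
  shows "a + b \<bullet> x = 0"
proof -
  have "a + b \<bullet> low_pt k = 0" "a + b \<bullet> high_pt k = 0" for k
    unfolding zeros_iff using assms(1) by (simp_all add: low_val_def high_val_def)
  then show ?thesis using assms(2) by (auto simp: low_pts_def high_pts_def)
qed

lemma zero_set:
  "{x \<in> low_pts \<union> high_pts. a + b \<bullet> x = 0}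
    = low_pt ` {k. k < n \<and> low_val d a (\<lambda>i. b \<bullet> bs i) k = 0}
      \<union> high_pt ` {k. k < n \<and> high_val d a (\<lambda>i. b \<bullet> bs i) k = 0}"
  by (auto simp: low_pts_def high_pts_def zeros_iff)

text \<open>Separating functionals for the indices of the zeros give separating affine functions for the points; with
\<open>simplicial_polytope_convex_hull\<close> this makes the polytope simplicial.\<close>

lemma zero_set_independent:
  assumes nonneg: "\<And>x. x \<in> low_pts \<union> high_pts \<Longrightarrow> 0 \<le> a + b \<bullet> x"
    and proper: "\<not> (\<forall>x\<in>low_pts \<union> high_pts. a + b \<bullet> x = 0)"
  shows "\<not> affine_dependent {x \<in> low_pts \<union> high_pts. a + b \<bullet> x = 0}"
proof -
  interpret supporting_functional d n a "\<lambda>i. b \<bullet> bs i"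
    by (rule supporting[OF nonneg])
  have nonzero: "\<not> (a = 0 \<and> (\<forall>i<d. b \<bullet> bs i = 0))"
    using vanishing_functional proper by blast
  have eq: "{x \<in> low_pts \<union> high_pts. a + b \<bullet> x = 0} = low_pt ` low_zeros \<union> high_pt ` high_zeros"
    unfolding low_zeros_def high_zeros_def by (rule zero_set)
  show ?thesis unfolding eq
  proof (rule affine_independent_by_separation)
    fix x assume "x \<in> low_pt ` low_zeros \<union> high_pt ` high_zeros"
    then consider s where "s \<in> low_zeros" "x = low_pt s" | s where "s \<in> high_zeros" "x = high_pt s"
      by blast
    then show "\<exists>a' b'. a' + b' \<bullet> x \<noteq> 0
      \<and> (\<forall>y\<in>low_pt ` low_zeros \<union> high_pt ` high_zeros - {x}. a' + b' \<bullet> y = 0)"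
    proof cases
      case 1
      obtain a' \<beta>' where "low_val d a' \<beta>' s \<noteq> 0"
        "\<And>k. k \<in> low_zeros \<Longrightarrow> k \<noteq> s \<Longrightarrow> low_val d a' \<beta>' k = 0"
        "\<And>k. k \<in> high_zeros \<Longrightarrow> high_val d a' \<beta>' k = 0"
        by (rule low_zero_separation[OF nonzero 1(1)]) (rule that)
      moreover obtain b' where "\<And>k. a' + b' \<bullet> low_pt k = low_val d a' \<beta>' k / low_scale d k"
        "\<And>k. a' + b' \<bullet> high_pt k = high_val d a' \<beta>' k / high_scale d k"
        by (rule functional_realized[of a' \<beta>']) (rule that)
      ultimately show ?thesis
        using 1 scale_pos by (intro exI[of _ a'] exI[of _ b']) (auto simp: less_imp_neq[symmetric], metis)
    next
      case 2
      obtain a' \<beta>' where "high_val d a' \<beta>' s \<noteq> 0"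
        "\<And>k. k \<in> high_zeros \<Longrightarrow> k \<noteq> s \<Longrightarrow> high_val d a' \<beta>' k = 0"
        "\<And>k. k \<in> low_zeros \<Longrightarrow> low_val d a' \<beta>' k = 0"
        by (rule high_zero_separation[OF nonzero 2(1)]) (rule that)
      moreover obtain b' where "\<And>k. a' + b' \<bullet> low_pt k = low_val d a' \<beta>' k / low_scale d k"
        "\<And>k. a' + b' \<bullet> high_pt k = high_val d a' \<beta>' k / high_scale d k"
        by (rule functional_realized[of a' \<beta>']) (rule that)
      ultimately show ?thesis
        using 2 scale_pos by (intro exI[of _ a'] exI[of _ b']) (auto simp: less_imp_neq[symmetric], metis)
    qed
  qed
qed

text \<open>A hyperplane through all points would be a functional with \<open>n > d\<close> zeros on the low cluster.\<close>

lemma aff_dim_pts: "aff_dim (low_pts \<union> high_pts) = int d"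
proof -
  have DIM: "DIM('a) = d" using bij_betw_same_card[OF bs] by simp
  have "\<not> aff_dim (low_pts \<union> high_pts) < int DIM('a)"
  proof
    assume "aff_dim (low_pts \<union> high_pts) < int DIM('a)"
    then obtain b c where b: "b \<noteq> 0" "low_pts \<union> high_pts \<subseteq> {x. b \<bullet> x = c}"
      using aff_lowdim_subset_hyperplane by blast
    have "low_val d (- c) (\<lambda>i. b \<bullet> bs i) k = 0" if "k \<in> {..<n}" for k
    proof -
      have "low_pt k \<in> low_pts \<union> high_pts" using that by (simp add: low_pts_def)
      then have "- c + b \<bullet> low_pt k = 0" using b(2) by auto
      then show ?thesis by (rule zeros_iff(1)[THEN iffD1])
    qed
    then have "\<forall>i<d. b \<bullet> bs i = 0"
      using many_low_zeros[of "{..<n}" d "- c" "\<lambda>i. b \<bullet> bs i"] n by simp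
    then have "b \<bullet> e = 0" if "e \<in> Basis" for e
      using that bij_betw_imp_surj_on[OF bs] by (metis imageE lessThan_iff)
    then have "b = 0" by (intro euclidean_all_zero_iff[THEN iffD1]) blast
    then show False using b(1) by simp
  qed
  then show ?thesis using DIM aff_dim_le_DIM[of "low_pts \<union> high_pts"] by linarith
qed

lemma graph_vertices_body: "graph_vertices body = low_pts \<union> high_pts"
  unfolding body_def
proof (rule graph_vertices_convex_hull[OF finite_pts(3)])
  fix x assume "x \<in> low_pts \<union> high_pts"
  then consider u where "u < n" "x = low_pt u" | u where "u < n" "x = high_pt u"
    by (auto simp: low_pts_def high_pts_def)
  then show "\<exists>a b. (\<forall>y\<in>low_pts \<union> high_pts. 0 \<le> a + b \<bullet> y)
    \<and> {y \<in> low_pts \<union> high_pts. a + b \<bullet> y = 0} = {x}"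
  proof cases
    case 1
    obtain a b where "\<And>k. 0 \<le> a + b \<bullet> low_pt k" "\<And>k. a + b \<bullet> low_pt k = 0 \<longleftrightarrow> k = u \<or> k = u"
      "\<And>k. 0 < a + b \<bullet> high_pt k"
      by (rule low_pair_exposed[of u u]) (rule that)
    then show ?thesis
      using 1 by (intro exI[of _ a] exI[of _ b]) (auto simp: low_pts_def high_pts_def less_imp_le less_imp_neq[symmetric])
  next
    case 2
    obtain a b where "\<And>k. 0 \<le> a + b \<bullet> high_pt k" "\<And>k. a + b \<bullet> high_pt k = 0 \<longleftrightarrow> k = u \<or> k = u"
      "\<And>k. 0 < a + b \<bullet> low_pt k"
      by (rule high_pair_exposed[of u u]) (rule that)
    then show ?thesis
      using 2 by (intro exI[of _ a] exI[of _ b]) (auto simp: low_pts_def high_pts_def less_imp_le less_imp_neq[symmetric])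
  qed
qed

lemma simplicial_body: "simplicial_polytope body"
  unfolding body_def
  by (rule simplicial_polytope_convex_hull[OF finite_pts(3) zero_set_independent])

lemma graph_edges_body:
  "e \<in> graph_edges body \<longleftrightarrow> (\<exists>a b. (\<forall>x\<in>low_pts \<union> high_pts. 0 \<le> a + b \<bullet> x)
    \<and> e = {x \<in> low_pts \<union> high_pts. a + b \<bullet> x = 0} \<and> card e = 2)"
  unfolding body_def
proof (rule graph_edges_convex_hull[OF finite_pts(3) _ _ zero_set_independent])
  show "graph_vertices (convex hull (low_pts \<union> high_pts)) = low_pts \<union> high_pts"
    using graph_vertices_body by (simp add: body_def)
  show "aff_dim (low_pts \<union> high_pts) \<noteq> 1" using aff_dim_pts d by simp
qed

lemma low_clique:
  assumes "x \<in> low_pts" "y \<in> low_pts" "x \<noteq> y"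
  shows "{x, y} \<in> graph_edges body"
proof -
  obtain u v where uv: "u < n" "v < n" "x = low_pt u" "y = low_pt v"
    using assms by (auto simp: low_pts_def)
  obtain a b where L: "\<And>k. 0 \<le> a + b \<bullet> low_pt k" "\<And>k. a + b \<bullet> low_pt k = 0 \<longleftrightarrow> k = u \<or> k = v"
    "\<And>k. 0 < a + b \<bullet> high_pt k"
    by (rule low_pair_exposed[of u v]) (rule that)
  have "{x, y} = {z \<in> low_pts \<union> high_pts. a + b \<bullet> z = 0}"
    using uv L by (auto simp: low_pts_def high_pts_def less_imp_neq[symmetric])
  moreover have "\<forall>x\<in>low_pts \<union> high_pts. 0 \<le> a + b \<bullet> x"
    using L by (auto simp: low_pts_def high_pts_def less_imp_le)
  moreover have "card {x, y} = 2" using assms(3) by simp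
  ultimately show ?thesis
    unfolding graph_edges_body by (intro exI[of _ a] exI[of _ b] conjI)
qed

lemma high_clique:
  assumes "x \<in> high_pts" "y \<in> high_pts" "x \<noteq> y"
  shows "{x, y} \<in> graph_edges body"
proof -
  obtain u v where uv: "u < n" "v < n" "x = high_pt u" "y = high_pt v"
    using assms by (auto simp: high_pts_def)
  obtain a b where L: "\<And>k. 0 \<le> a + b \<bullet> high_pt k" "\<And>k. a + b \<bullet> high_pt k = 0 \<longleftrightarrow> k = u \<or> k = v"
    "\<And>k. 0 < a + b \<bullet> low_pt k"
    by (rule high_pair_exposed[of u v]) (rule that)
  have "{x, y} = {z \<in> low_pts \<union> high_pts. a + b \<bullet> z = 0}"
    using uv L by (auto simp: low_pts_def high_pts_def less_imp_neq[symmetric])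
  moreover have "\<forall>x\<in>low_pts \<union> high_pts. 0 \<le> a + b \<bullet> x"
    using L by (auto simp: low_pts_def high_pts_def less_imp_le)
  moreover have "card {x, y} = 2" using assms(3) by simp
  ultimately show ?thesis
    unfolding graph_edges_body by (intro exI[of _ a] exI[of _ b] conjI)
qed

text \<open>An edge that joined other pairs would give a proper zero set of a pattern excluded by
\<open>zeros_crossing\<close>.\<close>

lemma crossing_edge_iff:
  assumes "u < n" "v < n"
  shows "{low_pt u, high_pt v} \<in> graph_edges body \<longleftrightarrow> u < d \<and> v \<le> u"
proof
  assume "{low_pt u, high_pt v} \<in> graph_edges body"
  then obtain a b where nonneg: "\<forall>x\<in>low_pts \<union> high_pts. 0 \<le> a + b \<bullet> x"
    and e: "{low_pt u, high_pt v} = {x \<in> low_pts \<union> high_pts. a + b \<bullet> x = 0}"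
    unfolding graph_edges_body by blast
  interpret supporting_functional d n a "\<lambda>i. b \<bullet> bs i"
    by (rule supporting) (use nonneg in blast)
  have "\<not> (\<forall>x\<in>low_pts \<union> high_pts. a + b \<bullet> x = 0)"
  proof
    assume "\<forall>x\<in>low_pts \<union> high_pts. a + b \<bullet> x = 0"
    then have "low_pts \<union> high_pts = {low_pt u, high_pt v}" using e by blast
    then have "aff_dim (low_pts \<union> high_pts) = 1"
      using low_pt_neq_high_pt by (simp add: aff_dim_2)
    then show False using aff_dim_pts d by simp
  qed
  then have nonzero: "\<not> (a = 0 \<and> (\<forall>i<d. b \<bullet> bs i = 0))"
    using vanishing_functional by blast
  have "a + b \<bullet> low_pt u = 0" "a + b \<bullet> high_pt v = 0" using e by auto
  then have "u \<in> low_zeros" "v \<in> high_zeros"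
    using assms by (simp_all add: low_zeros_def high_zeros_def zeros_iff)
  then show "u < d \<and> v \<le> u" using zeros_crossing[OF nonzero] by blast
next
  assume uv: "u < d \<and> v \<le> u"
  obtain a b where L: "\<And>k. 0 \<le> a + b \<bullet> low_pt k" "\<And>k. a + b \<bullet> low_pt k = 0 \<longleftrightarrow> k = u"
    "\<And>k. 0 \<le> a + b \<bullet> high_pt k" "\<And>k. a + b \<bullet> high_pt k = 0 \<longleftrightarrow> k = v"
    by (rule crossing_pair_exposed[of u v]) (use uv that in blast)+
  have "{low_pt u, high_pt v} = {z \<in> low_pts \<union> high_pts. a + b \<bullet> z = 0}"
    using assms L by (auto simp: low_pts_def high_pts_def)
  moreover have "\<forall>x\<in>low_pts \<union> high_pts. 0 \<le> a + b \<bullet> x"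
    using L by (auto simp: low_pts_def high_pts_def)
  moreover have "card {low_pt u, high_pt v} = 2" using low_pt_neq_high_pt by simp
  ultimately show "{low_pt u, high_pt v} \<in> graph_edges body"
    unfolding graph_edges_body by (intro exI[of _ a] exI[of _ b] conjI)
qed

lemma card_crossing_edges:
  "card (edges_between (graph_edges body) low_pts high_pts) = d * (d + 1) div 2"
proof -
  have "edges_between (graph_edges body) low_pts high_pts
      = (\<lambda>(i, j). {low_pt i, high_pt j}) ` {(i, j). i < d \<and> j \<le> i}"
  proof
    show "edges_between (graph_edges body) low_pts high_pts
      \<subseteq> (\<lambda>(i, j). {low_pt i, high_pt j}) ` {(i, j). i < d \<and> j \<le> i}"
    proof
      fix e assume "e \<in> edges_between (graph_edges body) low_pts high_pts"
      then obtain u v where "u < n" "v < n" "e = {low_pt u, high_pt v}" "e \<in> graph_edges body"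
        by (auto simp: edges_between_def low_pts_def high_pts_def)
      then show "e \<in> (\<lambda>(i, j). {low_pt i, high_pt j}) ` {(i, j). i < d \<and> j \<le> i}"
        using crossing_edge_iff by (intro image_eqI[of _ _ "(u, v)"]) auto
    qed
    show "(\<lambda>(i, j). {low_pt i, high_pt j}) ` {(i, j). i < d \<and> j \<le> i}
      \<subseteq> edges_between (graph_edges body) low_pts high_pts"
    proof
      fix e assume "e \<in> (\<lambda>(i, j). {low_pt i, high_pt j}) ` {(i, j). i < d \<and> j \<le> i}"
      then obtain i j where ij: "i < d" "j \<le> i" "e = {low_pt i, high_pt j}" by auto
      then have "i < n" "j < n" using n by auto
      then show "e \<in> edges_between (graph_edges body) low_pts high_pts"
        using ij crossing_edge_iff[of i j] unfolding edges_between_def low_pts_def high_pts_def by blast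
    qed
  qed
  moreover have "inj_on (\<lambda>(i, j). {low_pt i, high_pt j}) {(i, j). i < d \<and> j \<le> i}"
    using low_pt_neq_high_pt inj_low_pt inj_high_pt
    by (auto simp: inj_on_def doubleton_eq_iff)
  ultimately show ?thesis by (simp add: card_image card_ordered_pairs)
qed

lemma finite_graph_edges_body: "finite (graph_edges body)"
proof (rule finite_subset)
  show "graph_edges body \<subseteq> Pow (low_pts \<union> high_pts)" by (auto simp: graph_edges_body)
qed (use finite_pts in simp)

lemma card_pts: "card low_pts = n" "card high_pts = n"
  using inj_low_pt inj_high_pt
  by (simp_all add: low_pts_def high_pts_def card_image inj_on_subset[of _ UNIV])

lemma disjoint_pts: "low_pts \<inter> high_pts = {}"
  using low_pt_neq_high_pt by (auto simp: low_pts_def high_pts_def)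

end

theorem proposition15:
  fixes d :: nat
  assumes "d \<ge> 4" and "DIM('a::euclidean_space) = d"
  shows "\<exists>P :: 'a set.
    simplicial_polytope P \<and> aff_dim P = int d \<and>
    min_degree (graph_vertices P) (graph_edges P) \<ge> d * (d + 1) div 2 \<and>
    (\<exists>C. minimum_edge_cut (graph_vertices P) (graph_edges P) C \<and>
         \<not> trivial_edge_cut (graph_vertices P) (graph_edges P) C \<and>
         card C = d * (d + 1) div 2)"
proof -
  obtain bs :: "nat \<Rightarrow> 'a" where bs: "bij_betw bs {..<d} Basis"
    using ex_bij_betw_nat_finite[of "Basis :: 'a set"] assms(2) by (auto simp: atLeast0LessThan)
  define n where "n = d * (d + 1) div 2 + 1"
  have "d * 2 \<le> d * (d + 1)" using assms(1) by (intro mult_left_mono) auto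
  then have n: "d < n" unfolding n_def by linarith
  interpret two_clusters d n bs
    by unfold_locales (fact assms(1) n bs)+
  have "low_pts \<noteq> {}" "high_pts \<noteq> {}"
    using n by (auto simp: low_pts_def high_pts_def)
  note cut = two_cliques_minimum_edge_cut[OF finite_pts(1,2) finite_graph_edges_body disjoint_pts this
      low_clique high_clique card_crossing_edges]
  have small: "d * (d + 1) div 2 < card low_pts" "d * (d + 1) div 2 < card high_pts"
    "2 \<le> card low_pts" "2 \<le> card high_pts"
    unfolding card_pts using n assms(1) by (simp_all add: n_def)
  show ?thesis
  proof (intro exI conjI)
    show "simplicial_polytope body" by (rule simplicial_body)
    show "aff_dim body = int d" using aff_dim_pts by (simp add: body_def aff_dim_convex_hull)
    show "d * (d + 1) div 2 \<le> min_degree (graph_vertices body) (graph_edges body)"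
      unfolding graph_vertices_body by (rule cut(1)) (use small in auto)
    show "minimum_edge_cut (graph_vertices body) (graph_edges body)
        (edges_between (graph_edges body) low_pts high_pts)"
      unfolding graph_vertices_body by (rule cut(2)) (use small in auto)
    show "\<not> trivial_edge_cut (graph_vertices body) (graph_edges body)
        (edges_between (graph_edges body) low_pts high_pts)"
      unfolding graph_vertices_body by (rule cut(3)) (use small in auto)
    show "card (edges_between (graph_edges body) low_pts high_pts) = d * (d + 1) div 2"
      by (rule card_crossing_edges)
  qed
qed

end
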